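(* Let $\widetilde W=W_{\mathrm{aff}}\rtimes\Omega=\Lambda\rtimes W_\circ$ be a quasi-Coxeter group and $\mathcal H$ a Hecke algebra on $\widetilde W$ with parameters $q:\Delta_{\mathrm{aff}}\to\mathbf N$. Let $L\in\mathbf N$ and $\tau\in\Omega$. Let $Z_{L,\tau}(\mathcal H)$ be the set of all $z\in Z(\mathcal H)$ such that $z_w=0$ whenever $\ell(w)>L$ or $\Omega(w)\ne\tau$, and let $N_{L,\tau}$ be the number of $W_\circ$-conjugacy classes $\mathcal O\in\Lambda/W_\circ$ such that $\ell(\mathcal O)\le L$ and $\Omega(t)=\tau$ for all $t\in\mathcal O$. Then $$\dim_{\mathbf C} Z_{L,\tau}(\mathcal H)\le N_{L,\tau}.$$
   Context: Affine Weyl group. $\Sigma$ is a reduced irreducible root system with finite Weyl group $W_\circ$; $\mathcal A$ is the real vector space spanned by $\Sigma^\vee$; hyperplanes are the null-sets in $\mathcal A$ of affine functionals $\alpha+k$, $\alpha\in\Sigma$, $k\in\mathbf Z$; $W_{\mathrm{aff}}$ is the group generated by the reflections across all hyperplanes; alcoves are the connected components of the complement of all hyperplanes. Fix a special vertex $v_\circ$ (one through which, for each $\alpha\in\Sigma$, some hyperplane $\alpha+k=0$ passes), identify $W_\circ$ with its stabilizer in $W_{\mathrm{aff}}$, and fix an alcove $\mathfrak A_\circ$ with $v_\circ$ in its closure. $\Delta_{\mathrm{aff}}$ is the set of reflections in the walls of $\mathfrak A_\circ$; $\ell$ is the Coxeter length of $(W_{\mathrm{aff}},\Delta_{\mathrm{aff}})$.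 Quasi-Coxeter group. $\Omega$ is a finitely generated abelian group with a homomorphism $\psi$ to the group of invertible affine transformations of $\mathcal A$ normalizing $W_{\mathrm{aff}}$; $\widetilde W=W_{\mathrm{aff}}\rtimes\Omega$ (with $\Omega$ acting on $W_{\mathrm{aff}}$ by conjugation via $\psi$) acts on $\mathcal A$ by $(w,\tau)(a)=w(\psi(\tau)(a))$; $\ell(w,\tau)=\ell(w)$; $\Omega(w)$ is the projection of $w\in\widetilde W$ to $\Omega$. $\Lambda\subset\widetilde W$ is the subgroup of all elements acting on $\mathcal A$ by translations. Assumed: $\tau(\mathfrak A_\circ)=\mathfrak A_\circ$ for all $\tau\in\Omega$; $\widetilde W=\Lambda\rtimes W_\circ$; $\ell$ is constant on each $W_\circ$-conjugacy class $\mathcal O$ in $\Lambda$ (its value is $\ell(\mathcal O)$); $\Lambda$ is finitely generated and abelian. $\Lambda/W_\circ$ denotes the set of $W_\circ$-conjugacy classes in $\Lambda$. Hecke algebra. $q:\Delta_{\mathrm{aff}}\to\mathbf N$ is invariant under conjugation by $\widetilde W$ ($\mathbf N$ includes $0$). $\mathcal H$ is a $\mathbf C$-algebra with multiplication $*$ and $\mathbf C$-basis $\{T_w\}_{w\in\widetilde W}$ such that for all $w\in\widetilde W$, $s\in\Delta_{\mathrm{aff}}$: $T_s*T_w=T_{sw}$ if $\ell(sw)>\ell(w)$ and $T_s*T_w=(q(s)-1)T_w+q(s)T_{sw}$ if $\ell(sw)<\ell(w)$; $T_w*T_s=T_{ws}$ if $\ell(ws)>\ell(w)$ and $T_w*T_s=(q(s)-1)T_w+q(s)T_{ws}$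 if $\ell(ws)<\ell(w)$; moreover $T_w*T_\tau=T_{w\tau}$ and $T_\tau*T_w=T_{\tau w}$ for $\tau\in\Omega$. For $h\in\mathcal H$, $h_w$ is the coefficient of $T_w$ in $h$. $Z(\mathcal H)$ is the center of $\mathcal H$. *)

theory Defs
  imports "HOL-Analysis.Analysis" "HOL-Algebra.Generated_Groups" "HOL-Algebra.Group_Action"
begin

section \<open>Root systems and the affine Weyl group\<close>

text \<open>
  A root system is given inside a Euclidean space which it spans. A root \<open>\<alpha>\<close> is used as
  the linear functional \<open>x \<mapsto> \<alpha> \<bullet> x\<close>, and coroots are vectors of the same space. Since the
  coroots span this space as well, the space \<open>\<A>\<close> of the affine Weyl group is the whole type.
\<close>

definition coroot :: "'a::euclidean_space \<Rightarrow> 'a" where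
  "coroot \<alpha> = (2 / (\<alpha> \<bullet> \<alpha>)) *\<^sub>R \<alpha>"

definition root_system :: "'a::euclidean_space set \<Rightarrow> bool" where
  "root_system \<Sigma> \<longleftrightarrow> finite \<Sigma> \<and> 0 \<notin> \<Sigma> \<and> span \<Sigma> = UNIV \<and>
     (\<forall>\<alpha>\<in>\<Sigma>. \<forall>\<beta>\<in>\<Sigma>. \<beta> - (\<beta> \<bullet> coroot \<alpha>) *\<^sub>R \<alpha> \<in> \<Sigma>) \<and>
     (\<forall>\<alpha>\<in>\<Sigma>. \<forall>\<beta>\<in>\<Sigma>. \<beta> \<bullet> coroot \<alpha> \<in> \<int>)"

definition reduced :: "'a::euclidean_space set \<Rightarrow> bool" where
  "reduced \<Sigma> \<longleftrightarrow> (\<forall>\<alpha>\<in>\<Sigma>. \<forall>c. c *\<^sub>R \<alpha> \<in> \<Sigma> \<longrightarrow> c = 1 \<or> c = -1)"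

definition irreducible_roots :: "'a::euclidean_space set \<Rightarrow> bool" where
  "irreducible_roots \<Sigma> \<longleftrightarrow> \<Sigma> \<noteq> {} \<and>
     \<not> (\<exists>A B. A \<union> B = \<Sigma> \<and> A \<noteq> {} \<and> B \<noteq> {} \<and> (\<forall>\<alpha>\<in>A. \<forall>\<beta>\<in>B. \<alpha> \<bullet> \<beta> = 0))"

definition root_hyperplane :: "'a::euclidean_space \<Rightarrow> int \<Rightarrow> 'a set" where
  "root_hyperplane \<alpha> k = {x. \<alpha> \<bullet> x + of_int k = 0}"

definition affine_reflection :: "'a::euclidean_space \<Rightarrow> int \<Rightarrow> 'a \<Rightarrow> 'a" where
  "affine_reflection \<alpha> k x = x - (\<alpha> \<bullet> x + of_int k) *\<^sub>R coroot \<alpha>"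

definition alcoves :: "'a::euclidean_space set \<Rightarrow> 'a set set" where
  "alcoves \<Sigma> = components (- (\<Union>\<alpha>\<in>\<Sigma>. \<Union>k. root_hyperplane \<alpha> k))"

definition special_vertex :: "'a::euclidean_space set \<Rightarrow> 'a \<Rightarrow> bool" where
  "special_vertex \<Sigma> v \<longleftrightarrow> (\<forall>\<alpha>\<in>\<Sigma>. \<exists>k. v \<in> root_hyperplane \<alpha> k)"

definition affine_group :: "('a::euclidean_space \<Rightarrow> 'a) monoid" where
  "affine_group =
     \<lparr>carrier = {f. bij f \<and> (\<exists>A b. linear A \<and> f = (\<lambda>x. A x + b))}, mult = (\<circ>), one = id\<rparr>"

definition W_aff :: "'a::euclidean_space set \<Rightarrow> ('a \<Rightarrow> 'a) set" where
  "W_aff \<Sigma> = generate affine_group {affine_reflection \<alpha> k | \<alpha> k. \<alpha> \<in> \<Sigma>}"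

text \<open>
  A wall of an alcove is a hyperplane of the arrangement that is the affine support of a
  codimension one face of the alcove.
\<close>

definition wall :: "'a::euclidean_space set \<Rightarrow> 'a set \<Rightarrow> bool" where
  "wall C H \<longleftrightarrow> affine hull (H \<inter> closure C) = H"

definition \<Delta>_aff :: "'a::euclidean_space set \<Rightarrow> 'a set \<Rightarrow> ('a \<Rightarrow> 'a) set" where
  "\<Delta>_aff \<Sigma> C = {affine_reflection \<alpha> k | \<alpha> k. \<alpha> \<in> \<Sigma> \<and> wall C (root_hyperplane \<alpha> k)}"

definition coxeter_length :: "('a \<Rightarrow> 'a) set \<Rightarrow> ('a \<Rightarrow> 'a) \<Rightarrow> nat" where
  "coxeter_length S w = (LEAST n. \<exists>ss. set ss \<subseteq> S \<and> length ss = n \<and> w = foldr (\<circ>) ss id)"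

section \<open>Quasi-Coxeter groups\<close>

definition finitely_generated :: "('g, 'm) monoid_scheme \<Rightarrow> bool" where
  "finitely_generated G \<longleftrightarrow> (\<exists>F. finite F \<and> F \<subseteq> carrier G \<and> generate G F = carrier G)"

definition internal_semidirect :: "('g, 'm) monoid_scheme \<Rightarrow> 'g set \<Rightarrow> 'g set \<Rightarrow> bool" where
  "internal_semidirect G N H \<longleftrightarrow>
     N \<lhd> G \<and> subgroup H G \<and> N \<inter> H = {\<one>\<^bsub>G\<^esub>} \<and> N <#>\<^bsub>G\<^esub> H = carrier G"

definition conjugate :: "('g, 'm) monoid_scheme \<Rightarrow> 'g \<Rightarrow> 'g \<Rightarrow> 'g" where
  "conjugate G x y = x \<otimes>\<^bsub>G\<^esub> y \<otimes>\<^bsub>G\<^esub> inv\<^bsub>G\<^esub> x"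

definition W_tilde ::
  "'a::euclidean_space set \<Rightarrow> ('o, 'm) monoid_scheme \<Rightarrow> ('o \<Rightarrow> 'a \<Rightarrow> 'a) \<Rightarrow> (('a \<Rightarrow> 'a) \<times> 'o) monoid"
where
  "W_tilde \<Sigma> \<Omega> \<psi> =
     \<lparr>carrier = W_aff \<Sigma> \<times> carrier \<Omega>,
      mult = (\<lambda>(w, \<sigma>) (w', \<sigma>'). (w \<circ> conjugate affine_group (\<psi> \<sigma>) w', \<sigma> \<otimes>\<^bsub>\<Omega>\<^esub> \<sigma>')),
      one = (id, \<one>\<^bsub>\<Omega>\<^esub>)\<rparr>"

definition action :: "('o \<Rightarrow> 'a \<Rightarrow> 'a) \<Rightarrow> ('a \<Rightarrow> 'a) \<times> 'o \<Rightarrow> 'a \<Rightarrow> 'a" where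
  "action \<psi> x a = fst x (\<psi> (snd x) a)"

definition \<Lambda> ::
  "'a::euclidean_space set \<Rightarrow> ('o, 'm) monoid_scheme \<Rightarrow> ('o \<Rightarrow> 'a \<Rightarrow> 'a) \<Rightarrow> (('a \<Rightarrow> 'a) \<times> 'o) set" where
  "\<Lambda> \<Sigma> \<Omega> \<psi> = {x \<in> carrier (W_tilde \<Sigma> \<Omega> \<psi>). \<exists>v. \<forall>a. action \<psi> x a = a + v}"

text \<open>The finite Weyl group, identified with the stabilizer of the special vertex \<open>v\<close> in
  \<open>W_aff\<close>, as a subset of \<open>W_tilde\<close>.\<close>

definition W_fin ::
  "'a::euclidean_space set \<Rightarrow> 'a \<Rightarrow> ('o, 'm) monoid_scheme \<Rightarrow> (('a \<Rightarrow> 'a) \<times> 'o) set" where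
  "W_fin \<Sigma> v \<Omega> = {(w, \<one>\<^bsub>\<Omega>\<^esub>) | w. w \<in> W_aff \<Sigma> \<and> w v = v}"

definition len :: "'a::euclidean_space set \<Rightarrow> 'a set \<Rightarrow> ('a \<Rightarrow> 'a) \<times> 'o \<Rightarrow> nat" where
  "len \<Sigma> C x = coxeter_length (\<Delta>_aff \<Sigma> C) (fst x)"

definition conj_classes ::
  "'a::euclidean_space set \<Rightarrow> 'a \<Rightarrow> ('o, 'm) monoid_scheme \<Rightarrow> ('o \<Rightarrow> 'a \<Rightarrow> 'a)
    \<Rightarrow> (('a \<Rightarrow> 'a) \<times> 'o) set set" where
  "conj_classes \<Sigma> v \<Omega> \<psi> =
     {(\<lambda>w. conjugate (W_tilde \<Sigma> \<Omega> \<psi>) w t) ` W_fin \<Sigma> v \<Omega> | t. t \<in> \<Lambda> \<Sigma> \<Omega> \<psi>}"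

text \<open>The common length of the elements of a class on which the length is constant.\<close>

definition class_len :: "'a::euclidean_space set \<Rightarrow> 'a set \<Rightarrow> (('a \<Rightarrow> 'a) \<times> 'o) set \<Rightarrow> nat" where
  "class_len \<Sigma> C K = the_elem (len \<Sigma> C ` K)"

locale quasi_coxeter_group =
  fixes \<Sigma> :: "'a::euclidean_space set"
    and v :: 'a
    and C :: "'a set"
    and \<Omega> :: "('o, 'm) monoid_scheme"
    and \<psi> :: "'o \<Rightarrow> 'a \<Rightarrow> 'a"
  assumes roots: "root_system \<Sigma>" "reduced \<Sigma>" "irreducible_roots \<Sigma>"
    and vertex: "special_vertex \<Sigma> v"
    and alcove: "C \<in> alcoves \<Sigma>" "v \<in> closure C"
    and Omega: "comm_group \<Omega>" "finitely_generated \<Omega>"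
    and psi_hom: "\<psi> \<in> hom \<Omega> (affine_group\<lparr>carrier := normalizer affine_group (W_aff \<Sigma>)\<rparr>)"
    and psi_alcove: "\<And>\<tau>. \<tau> \<in> carrier \<Omega> \<Longrightarrow> \<psi> \<tau> ` C = C"
    and semidirect: "internal_semidirect (W_tilde \<Sigma> \<Omega> \<psi>) (\<Lambda> \<Sigma> \<Omega> \<psi>) (W_fin \<Sigma> v \<Omega>)"
    and len_conj: "\<And>w t. w \<in> W_fin \<Sigma> v \<Omega> \<Longrightarrow> t \<in> \<Lambda> \<Sigma> \<Omega> \<psi> \<Longrightarrow>
          len \<Sigma> C (conjugate (W_tilde \<Sigma> \<Omega> \<psi>) w t) = len \<Sigma> C t"
    and Lambda: "comm_group ((W_tilde \<Sigma> \<Omega> \<psi>)\<lparr>carrier := \<Lambda> \<Sigma> \<Omega> \<psi>\<rparr>)"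
      "finitely_generated ((W_tilde \<Sigma> \<Omega> \<psi>)\<lparr>carrier := \<Lambda> \<Sigma> \<Omega> \<psi>\<rparr>)"

section \<open>Hecke algebras\<close>

text \<open>The family \<open>T\<close> is only relevant on the carrier of \<open>W_tilde\<close>, where it is a basis.\<close>

locale hecke_algebra =
  quasi_coxeter_group \<Sigma> v C \<Omega> \<psi> + H: vector_space smul
  for \<Sigma> :: "'a::euclidean_space set"
    and v :: 'a
    and C :: "'a set"
    and \<Omega> :: "('o, 'm) monoid_scheme"
    and \<psi> :: "'o \<Rightarrow> 'a \<Rightarrow> 'a"
    and smul :: "complex \<Rightarrow> 'h::ring_1 \<Rightarrow> 'h" +
  fixes q :: "('a \<Rightarrow> 'a) \<Rightarrow> nat"
    and T :: "('a \<Rightarrow> 'a) \<times> 'o \<Rightarrow> 'h"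
  assumes q_conj: "\<And>x s s'. x \<in> carrier (W_tilde \<Sigma> \<Omega> \<psi>) \<Longrightarrow> s \<in> \<Delta>_aff \<Sigma> C \<Longrightarrow> s' \<in> \<Delta>_aff \<Sigma> C \<Longrightarrow>
          conjugate (W_tilde \<Sigma> \<Omega> \<psi>) x (s, \<one>\<^bsub>\<Omega>\<^esub>) = (s', \<one>\<^bsub>\<Omega>\<^esub>) \<Longrightarrow> q s' = q s"
    and scale_mult: "\<And>c x y. smul c (x * y) = smul c x * y"
      "\<And>c x y. smul c (x * y) = x * smul c y"
    and T_basis: "inj_on T (carrier (W_tilde \<Sigma> \<Omega> \<psi>))"
      "H.independent (T ` carrier (W_tilde \<Sigma> \<Omega> \<psi>))"
      "H.span (T ` carrier (W_tilde \<Sigma> \<Omega> \<psi>)) = UNIV"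
    and T_left_up: "\<And>s w. s \<in> \<Delta>_aff \<Sigma> C \<Longrightarrow> w \<in> carrier (W_tilde \<Sigma> \<Omega> \<psi>) \<Longrightarrow>
          len \<Sigma> C ((s, \<one>\<^bsub>\<Omega>\<^esub>) \<otimes>\<^bsub>W_tilde \<Sigma> \<Omega> \<psi>\<^esub> w) > len \<Sigma> C w \<Longrightarrow>
          T (s, \<one>\<^bsub>\<Omega>\<^esub>) * T w = T ((s, \<one>\<^bsub>\<Omega>\<^esub>) \<otimes>\<^bsub>W_tilde \<Sigma> \<Omega> \<psi>\<^esub> w)"
    and T_left_down: "\<And>s w. s \<in> \<Delta>_aff \<Sigma> C \<Longrightarrow> w \<in> carrier (W_tilde \<Sigma> \<Omega> \<psi>) \<Longrightarrow>
          len \<Sigma> C ((s, \<one>\<^bsub>\<Omega>\<^esub>) \<otimes>\<^bsub>W_tilde \<Sigma> \<Omega> \<psi>\<^esub> w) < len \<Sigma> C w \<Longrightarrow>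
          T (s, \<one>\<^bsub>\<Omega>\<^esub>) * T w = smul (of_nat (q s) - 1) (T w)
            + smul (of_nat (q s)) (T ((s, \<one>\<^bsub>\<Omega>\<^esub>) \<otimes>\<^bsub>W_tilde \<Sigma> \<Omega> \<psi>\<^esub> w))"
    and T_right_up: "\<And>s w. s \<in> \<Delta>_aff \<Sigma> C \<Longrightarrow> w \<in> carrier (W_tilde \<Sigma> \<Omega> \<psi>) \<Longrightarrow>
          len \<Sigma> C (w \<otimes>\<^bsub>W_tilde \<Sigma> \<Omega> \<psi>\<^esub> (s, \<one>\<^bsub>\<Omega>\<^esub>)) > len \<Sigma> C w \<Longrightarrow>
          T w * T (s, \<one>\<^bsub>\<Omega>\<^esub>) = T (w \<otimes>\<^bsub>W_tilde \<Sigma> \<Omega> \<psi>\<^esub> (s, \<one>\<^bsub>\<Omega>\<^esub>))"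
    and T_right_down: "\<And>s w. s \<in> \<Delta>_aff \<Sigma> C \<Longrightarrow> w \<in> carrier (W_tilde \<Sigma> \<Omega> \<psi>) \<Longrightarrow>
          len \<Sigma> C (w \<otimes>\<^bsub>W_tilde \<Sigma> \<Omega> \<psi>\<^esub> (s, \<one>\<^bsub>\<Omega>\<^esub>)) < len \<Sigma> C w \<Longrightarrow>
          T w * T (s, \<one>\<^bsub>\<Omega>\<^esub>) = smul (of_nat (q s) - 1) (T w)
            + smul (of_nat (q s)) (T (w \<otimes>\<^bsub>W_tilde \<Sigma> \<Omega> \<psi>\<^esub> (s, \<one>\<^bsub>\<Omega>\<^esub>)))"
    and T_Omega: "\<And>\<tau> w. \<tau> \<in> carrier \<Omega> \<Longrightarrow> w \<in> carrier (W_tilde \<Sigma> \<Omega> \<psi>) \<Longrightarrow>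
          T w * T (id, \<tau>) = T (w \<otimes>\<^bsub>W_tilde \<Sigma> \<Omega> \<psi>\<^esub> (id, \<tau>))"
      "\<And>\<tau> w. \<tau> \<in> carrier \<Omega> \<Longrightarrow> w \<in> carrier (W_tilde \<Sigma> \<Omega> \<psi>) \<Longrightarrow>
          T (id, \<tau>) * T w = T ((id, \<tau>) \<otimes>\<^bsub>W_tilde \<Sigma> \<Omega> \<psi>\<^esub> w)"

definition center :: "'h::ring_1 set" where
  "center = {z. \<forall>h. z * h = h * z}"

text \<open>The coefficient of \<open>T w\<close> in \<open>h\<close>, for the basis of all \<open>T x\<close> with \<open>x \<in> X\<close>.\<close>

definition hcoeff :: "(complex \<Rightarrow> 'h::ring_1 \<Rightarrow> 'h) \<Rightarrow> ('w \<Rightarrow> 'h) \<Rightarrow> 'w set \<Rightarrow> 'h \<Rightarrow> 'w \<Rightarrow> complex" where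
  "hcoeff smul T X h w = module.representation smul (T ` X) h (T w)"

definition Z_part ::
  "'a::euclidean_space set \<Rightarrow> 'a set \<Rightarrow> ('o, 'm) monoid_scheme \<Rightarrow> ('o \<Rightarrow> 'a \<Rightarrow> 'a)
    \<Rightarrow> (complex \<Rightarrow> 'h::ring_1 \<Rightarrow> 'h) \<Rightarrow> (('a \<Rightarrow> 'a) \<times> 'o \<Rightarrow> 'h) \<Rightarrow> nat \<Rightarrow> 'o \<Rightarrow> 'h set" where
  "Z_part \<Sigma> C \<Omega> \<psi> smul T L \<tau> =
     {z \<in> center. \<forall>w \<in> carrier (W_tilde \<Sigma> \<Omega> \<psi>).
        len \<Sigma> C w > L \<or> snd w \<noteq> \<tau> \<longrightarrow> hcoeff smul T (carrier (W_tilde \<Sigma> \<Omega> \<psi>)) z w = 0}"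

definition N_classes ::
  "'a::euclidean_space set \<Rightarrow> 'a \<Rightarrow> 'a set \<Rightarrow> ('o, 'm) monoid_scheme \<Rightarrow> ('o \<Rightarrow> 'a \<Rightarrow> 'a)
    \<Rightarrow> nat \<Rightarrow> 'o \<Rightarrow> (('a \<Rightarrow> 'a) \<times> 'o) set set" where
  "N_classes \<Sigma> v C \<Omega> \<psi> L \<tau> =
     {K \<in> conj_classes \<Sigma> v \<Omega> \<psi>. class_len \<Sigma> C K \<le> L \<and> (\<forall>t\<in>K. snd t = \<tau>)}"

end

theory Submission
  imports Defs
begin

text \<open>
  A central element \<open>z\<close> is determined by its coefficients on \<open>\<Lambda>\<close>. Suppose that the support of
  \<open>z \<noteq> 0\<close> does not meet \<open>\<Lambda>\<close>. Fix a point \<open>b\<close> of the alcove at which the displacement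
  \<open>\<parallel>x b - b\<parallel>\<close> has non-zero gradient for every \<open>x\<close> in the support, and among the longest
  \<open>x\<close> in the support choose one with maximal displacement. Some wall of the alcove, with
  reflection \<open>s\<close>, has its outward normal at an acute angle with the gradient. Then
  \<open>s x s\<close> has larger displacement than \<open>x\<close>, and \<open>s x\<close> or \<open>x s\<close> is longer than \<open>x\<close>.
  Comparing coefficients in \<open>T\<^sub>s * z = z * T\<^sub>s\<close> shows that either \<open>s x s\<close> has the same
  coefficient as \<open>x\<close>, against the choice of \<open>x\<close>, or the coefficient at \<open>x\<close> is a combination of
  coefficients at longer elements, hence zero. The same comparison at \<open>t \<in> \<Lambda>\<close> shows that the
  coefficients on \<open>\<Lambda>\<close> are constant on \<open>W_fin\<close>-conjugacy classes.
\<close>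

section \<open>Affine isometries and reflections\<close>

text \<open>The values \<open>q s\<close> may be 0, so a generator \<open>T s\<close> need not be
  invertible and centrality cannot be restated as invariance under conjugation. The relation is
  therefore read at one coefficient, at an element longer than \<open>x\<close>, where
  \<open>q s\<close> enters only as a factor and is never divided by. This works at maximal length
  in the support: there \<open>s x s\<close> cannot be longer, so conjugation stays among the
  longest elements, and the strictly growing displacement excludes cycling in a finite support. For
  a translation the gradient vanishes identically, so the argument stops exactly at
  \<open>\<Lambda>\<close>; for any other element it vanishes at most on a set without interior,
  hence the generic point \<open>b\<close>.

  Lengths are compared through signs of affine roots at points of the alcove. Walls, alcoves and
  length are given by bare definitions, so generation by wall reflections and the exchange condition
  have to be derived from the geometry first.\<close>

definition affine_root :: "'a::euclidean_space \<Rightarrow> int \<Rightarrow> 'a \<Rightarrow> real" where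
  "affine_root \<alpha> k x = \<alpha> \<bullet> x + of_int k"

definition affine_isometry :: "('a::euclidean_space \<Rightarrow> 'a) \<Rightarrow> bool" where
  "affine_isometry f \<longleftrightarrow> (\<exists>A b. orthogonal_transformation A \<and> f = (\<lambda>x. A x + b))"

lemma root_hyperplane_iff: "x \<in> root_hyperplane \<alpha> k \<longleftrightarrow> affine_root \<alpha> k x = 0"
  by (simp add: root_hyperplane_def affine_root_def)

lemma affine_reflection_eq: "affine_reflection \<alpha> k x = x - affine_root \<alpha> k x *\<^sub>R coroot \<alpha>"
  by (simp add: affine_reflection_def affine_root_def)

lemma inner_coroot: "\<alpha> \<noteq> 0 \<Longrightarrow> \<alpha> \<bullet> coroot \<alpha> = 2"
  by (simp add: coroot_def)

lemma affine_root_reflection: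
  "\<alpha> \<noteq> 0 \<Longrightarrow> affine_root \<alpha> k (affine_reflection \<alpha> k x) = - affine_root \<alpha> k x"
  by (simp add: affine_reflection_eq affine_root_def inner_diff_right inner_coroot)

lemma affine_reflection_fix: "affine_root \<alpha> k x = 0 \<Longrightarrow> affine_reflection \<alpha> k x = x"
  by (simp add: affine_reflection_eq)

lemma affine_reflection_involution:
  "\<alpha> \<noteq> 0 \<Longrightarrow> affine_reflection \<alpha> k (affine_reflection \<alpha> k x) = x"
  by (simp add: affine_reflection_eq[of _ _ "affine_reflection \<alpha> k x"] affine_root_reflection)
    (simp add: affine_reflection_eq)

lemma affine_reflection_comp_self:
  "\<alpha> \<noteq> 0 \<Longrightarrow> affine_reflection \<alpha> k \<circ> affine_reflection \<alpha> k = id"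
  by (auto simp: affine_reflection_involution)

lemma affine_isometry_id: "affine_isometry id"
  unfolding affine_isometry_def
  by (rule exI[of _ "\<lambda>x. x"], rule exI[of _ 0]) (auto simp: orthogonal_transformation_id)

lemma affine_isometry_translation: "affine_isometry (\<lambda>x. x + b)"
  unfolding affine_isometry_def
  by (rule exI[of _ "\<lambda>x. x"]) (auto simp: orthogonal_transformation_id)

lemma affine_isometry_comp:
  assumes "affine_isometry f" "affine_isometry g"
  shows "affine_isometry (f \<circ> g)"
proof -
  obtain A b A' b' where "orthogonal_transformation A" "f = (\<lambda>x. A x + b)"
    "orthogonal_transformation A'" "g = (\<lambda>x. A' x + b')"
    using assms unfolding affine_isometry_def by blast
  then show ?thesis
    unfolding affine_isometry_def
    by (intro exI[of _ "A \<circ> A'"] exI[of _ "A b' + b"])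
      (auto simp: orthogonal_transformation_compose linear_add[OF orthogonal_transformation_linear])
qed

lemma affine_isometry_reflection:
  assumes "\<alpha> \<noteq> 0"
  shows "affine_isometry (affine_reflection \<alpha> k)"
proof -
  let ?A = "\<lambda>x. x - (\<alpha> \<bullet> x) *\<^sub>R coroot \<alpha>"
  have "linear ?A"
    by (rule linearI) (auto simp: algebra_simps inner_add_right)
  moreover have "?A x \<bullet> ?A y = x \<bullet> y" for x y
    using assms
    by (simp add: inner_diff_left inner_diff_right coroot_def inner_commute field_simps)
  ultimately have "orthogonal_transformation ?A"
    by (auto simp: orthogonal_transformation_def)
  then show ?thesis
    unfolding affine_isometry_def
    by (intro exI[of _ ?A] exI[of _ "- of_int k *\<^sub>R coroot \<alpha>"])
      (auto simp: affine_reflection_def algebra_simps)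
qed

text \<open>Subtracting a multiple of \<alpha> moves \<open>x\<close> to its foot on the hyperplane,
  where the second functional vanishes; the factor is what that shift contributes. This turns an
  inclusion of hyperplanes into proportionality of functionals.\<close>

lemma affine_functional_multiple:
  assumes "\<alpha> \<noteq> 0" and "\<And>x. affine_root \<alpha> k x = 0 \<Longrightarrow> u \<bullet> x + d = 0"
  shows "u \<bullet> x + d = ((u \<bullet> \<alpha>) / (\<alpha> \<bullet> \<alpha>)) * affine_root \<alpha> k x"
proof -
  let ?y = "x - (affine_root \<alpha> k x / (\<alpha> \<bullet> \<alpha>)) *\<^sub>R \<alpha>"
  have "affine_root \<alpha> k ?y = 0"
    using assms(1) by (simp add: affine_root_def inner_diff_right)
  from assms(2)[OF this] show ?thesis
    by (simp add: inner_diff_right algebra_simps)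
qed

lemma affine_root_not_const: "\<alpha> \<noteq> 0 \<Longrightarrow> \<exists>x. affine_root \<alpha> k x \<noteq> 0"
  by (rule exI[of _ "((1 - of_int k) / (\<alpha> \<bullet> \<alpha>)) *\<^sub>R \<alpha>"]) (simp add: affine_root_def)

lemma root_hyperplane_nonempty: "\<alpha> \<noteq> 0 \<Longrightarrow> root_hyperplane \<alpha> k \<noteq> {}"
proof -
  assume "\<alpha> \<noteq> 0"
  then have "(- of_int k / (\<alpha> \<bullet> \<alpha>)) *\<^sub>R \<alpha> \<in> root_hyperplane \<alpha> k"
    by (simp add: root_hyperplane_def)
  then show ?thesis by blast
qed

lemma affine_isometry_linear_part:
  assumes "affine_isometry X"
  obtains A b where "orthogonal_transformation A" "linear A" "\<And>x. X x = A x + b"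
    "\<And>x y. A x \<bullet> A y = x \<bullet> y" "surj A"
proof -
  obtain A b where A: "orthogonal_transformation A" "X = (\<lambda>x. A x + b)"
    using assms unfolding affine_isometry_def by blast
  show ?thesis
    by (rule that[of A b]) (use A orthogonal_transformation_surj[OF A(1)] in
        \<open>auto simp: orthogonal_transformation_def\<close>)
qed

lemma affine_isometry_bij: "affine_isometry X \<Longrightarrow> bij X"
proof -
  assume "affine_isometry X"
  then obtain A b where A: "orthogonal_transformation A" "X = (\<lambda>x. A x + b)"
    unfolding affine_isometry_def by blast
  then have "X = (\<lambda>x. x + b) \<circ> A" by auto
  moreover have "bij (\<lambda>x. x + b)"
    by (rule bij_plus_right)
  ultimately show ?thesis
    using orthogonal_transformation_bij[OF A(1)] by (metis bij_comp)
qed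

lemma affine_isometry_dist:
  assumes "affine_isometry X"
  shows "norm (X x - X y) = norm (x - y)"
proof -
  obtain A b where A: "orthogonal_transformation A" "linear A" "\<And>x. X x = A x + b"
    using affine_isometry_linear_part[OF assms] by metis
  then have "X x - X y = A (x - y)" by (simp add: linear_diff)
  then show ?thesis using A(1) by (simp add: orthogonal_transformation_norm)
qed

text \<open>The condition \<open>val\<close> forces \<beta> to be \<open>c\<close> times the image
  of \<alpha> under the linear part of \<open>X\<close>; the coroot scales by \<open>1 / c\<close>,
  so the factor cancels. The factor is 1 for elements of \<open>W_aff\<close>, while for
  \<open>\<psi> \<tau>\<close> only proportionality is at hand.\<close>

lemma affine_reflection_conj:
  assumes "affine_isometry X" "c \<noteq> 0" "\<alpha> \<noteq> 0"
    and val: "\<And>x. affine_root \<beta> j (X x) = c * affine_root \<alpha> k x"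
  shows "affine_reflection \<beta> j (X x) = X (affine_reflection \<alpha> k x)"
proof -
  obtain A b where A: "linear A" "\<And>x. X x = A x + b" "\<And>x y. A x \<bullet> A y = x \<bullet> y" "surj A"
    using affine_isometry_linear_part[OF assms(1)] by metis
  have "\<beta> \<bullet> A x = c * (\<alpha> \<bullet> x)" for x
    using val[of x] val[of 0] linear_0[OF A(1)] by (simp add: affine_root_def A(2) algebra_simps)
  then have "(\<beta> - c *\<^sub>R A \<alpha>) \<bullet> A x = 0" for x
    by (simp add: inner_diff_left A(3))
  then have \<beta>: "\<beta> = c *\<^sub>R A \<alpha>"
    using A(4) by (metis eq_iff_diff_eq_0 inner_eq_zero_iff surjD)
  have "coroot \<beta> = (1 / c) *\<^sub>R A (coroot \<alpha>)"
    using assms(2,3) by (simp add: \<beta> coroot_def A(3) linear_scale[OF A(1)] field_simps)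
  then show ?thesis
    using assms(2) by (simp add: affine_reflection_eq val)
      (simp add: A(2) linear_diff[OF A(1)] linear_scale[OF A(1)])
qed

corollary affine_reflection_scale:
  assumes "c \<noteq> 0" "\<alpha> \<noteq> 0" "\<And>x. affine_root \<beta> j x = c * affine_root \<alpha> k x"
  shows "affine_reflection \<beta> j = affine_reflection \<alpha> k"
  using affine_reflection_conj[OF affine_isometry_id assms(1,2), of \<beta> j k] assms(3) by auto

lemma continuous_affine_root [continuous_intros]: "continuous_on S (affine_root \<alpha> k)"
  unfolding affine_root_def by (intro continuous_intros)

section \<open>Walls of an alcove\<close>

lemma in_closure_segmentI:
  fixes b x :: "'a::real_normed_vector"
  assumes "\<And>t. 0 < t \<Longrightarrow> t < 1 \<Longrightarrow> x + t *\<^sub>R (b - x) \<in> S"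
  shows "x \<in> closure S"
proof -
  have lim: "((\<lambda>t. x + t *\<^sub>R (b - x)) \<longlongrightarrow> x + 0 *\<^sub>R (b - x)) (at_right 0)"
    by (intro tendsto_intros)
  have "eventually (\<lambda>t::real. t \<in> {0<..<1}) (at_right 0)"
    by (rule eventually_at_right_real) simp
  then have "eventually (\<lambda>t. x + t *\<^sub>R (b - x) \<in> closure S) (at_right 0)"
    by eventually_elim (use assms closure_subset in auto)
  from Lim_in_closed_set[OF closed_closure this _ lim] show ?thesis by simp
qed

locale root_alcove =
  fixes \<Sigma> :: "'a::euclidean_space set" and C :: "'a set"
  assumes root_system: "root_system \<Sigma>"
    and alcove_C: "C \<in> alcoves \<Sigma>"
begin

lemma finite_roots: "finite \<Sigma>" and span_roots: "span \<Sigma> = UNIV"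
  using root_system by (auto simp: root_system_def)

lemma root_nonzero: "\<alpha> \<in> \<Sigma> \<Longrightarrow> \<alpha> \<noteq> 0"
  using root_system by (auto simp: root_system_def)

lemma root_reflection: "\<alpha> \<in> \<Sigma> \<Longrightarrow> \<beta> \<in> \<Sigma> \<Longrightarrow> \<beta> - (\<beta> \<bullet> coroot \<alpha>) *\<^sub>R \<alpha> \<in> \<Sigma>"
  and root_integral: "\<alpha> \<in> \<Sigma> \<Longrightarrow> \<beta> \<in> \<Sigma> \<Longrightarrow> \<beta> \<bullet> coroot \<alpha> \<in> \<int>"
  using root_system by (auto simp: root_system_def)

lemma root_minus: "\<alpha> \<in> \<Sigma> \<Longrightarrow> - \<alpha> \<in> \<Sigma>"
  using root_reflection[of \<alpha> \<alpha>] by (simp add: inner_coroot root_nonzero scaleR_2)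

text \<open>Integrality of the root system keeps the constant term \<open>j - k * n\<close> an
  integer, so reflections permute the hyperplanes of the arrangement.\<close>

lemma affine_root_comp_reflection:
  assumes "\<alpha> \<in> \<Sigma>" "\<beta> \<in> \<Sigma>"
  obtains \<gamma> i where "\<gamma> \<in> \<Sigma>" "\<And>x. affine_root \<beta> j (affine_reflection \<alpha> k x) = affine_root \<gamma> i x"
proof -
  obtain n :: int where n: "\<beta> \<bullet> coroot \<alpha> = of_int n"
    using root_integral[OF assms] by (auto elim: Ints_cases)
  show ?thesis
  proof (rule that)
    show "\<beta> - (\<beta> \<bullet> coroot \<alpha>) *\<^sub>R \<alpha> \<in> \<Sigma>" using root_reflection[OF assms] .
    show "affine_root \<beta> j (affine_reflection \<alpha> k x)
        = affine_root (\<beta> - (\<beta> \<bullet> coroot \<alpha>) *\<^sub>R \<alpha>) (j - k * n) x" for x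
      by (simp add: affine_reflection_def affine_root_def n inner_diff_right inner_diff_left algebra_simps)
  qed
qed

lemma alcove_nonempty: "C \<noteq> {}" and alcove_connected: "connected C"
  and affine_root_nonzero: "x \<in> C \<Longrightarrow> \<alpha> \<in> \<Sigma> \<Longrightarrow> affine_root \<alpha> k x \<noteq> 0"
  using alcove_C in_components_nonempty in_components_connected in_components_subset
  unfolding alcoves_def root_hyperplane_iff[symmetric] by blast+

definition base :: 'a where "base = (SOME x. x \<in> C)"

lemma base_in: "base \<in> C"
  unfolding base_def using alcove_nonempty by (simp add: some_in_eq)

text \<open>On the alcove \<alpha> is confined between two consecutive integers; this is the upper
  one. Hence \<open>root_hyperplane \<alpha> (- height \<alpha>)\<close> is the first hyperplane of
  \<alpha> met when leaving the alcove in direction \<alpha>.\<close>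

definition height :: "'a \<Rightarrow> int" where "height \<alpha> = \<lceil>\<alpha> \<bullet> base\<rceil>"

text \<open>The bounds are strict because no hyperplane meets the alcove. The third fact turns lower
  bounds for \<alpha> into upper bounds for \<open>- \<alpha>\<close>, so that the alcove can be
  described by upper bounds alone.\<close>

lemma base_bounds:
  assumes "\<alpha> \<in> \<Sigma>"
  shows "\<alpha> \<bullet> base < of_int (height \<alpha>)" "of_int (height \<alpha>) - 1 < \<alpha> \<bullet> base"
    "height (- \<alpha>) = 1 - height \<alpha>"
proof -
  have "\<alpha> \<bullet> base \<noteq> of_int k" for k
    using affine_root_nonzero[OF base_in assms, of "- k"] by (auto simp: affine_root_def)
  moreover have "\<alpha> \<bullet> base \<le> of_int (height \<alpha>)" "of_int (height \<alpha>) - 1 < \<alpha> \<bullet> base"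
    unfolding height_def by linarith+
  ultimately show *: "\<alpha> \<bullet> base < of_int (height \<alpha>)" "of_int (height \<alpha>) - 1 < \<alpha> \<bullet> base"
    by (metis order_le_less) fact
  show "height (- \<alpha>) = 1 - height \<alpha>"
    unfolding height_def[of "- \<alpha>"] using * by (simp add: ceiling_eq_iff)
qed

text \<open>A connected set that crossed a bound would meet a hyperplane. Conversely the
  intersection of half-spaces is convex and, by the bounds for \<alpha> and
  \<open>- \<alpha>\<close> together, meets no hyperplane, so it lies in the component of
  \<open>base\<close>.\<close>

lemma alcove_eq: "C = {x. \<forall>\<alpha>\<in>\<Sigma>. \<alpha> \<bullet> x < of_int (height \<alpha>)}" (is "_ = ?P")
proof
  show "C \<subseteq> ?P"
  proof (intro subsetI CollectI ballI)
    fix x \<alpha> assume x: "x \<in> C" and \<alpha>: "\<alpha> \<in> \<Sigma>"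
    show "\<alpha> \<bullet> x < of_int (height \<alpha>)"
    proof (rule ccontr)
      assume "\<not> ?thesis"
      then obtain z where "z \<in> C" "\<alpha> \<bullet> z = of_int (height \<alpha>)"
        using connected_ivt_hyperplane[OF alcove_connected base_in x, of \<alpha> "of_int (height \<alpha>)"]
          base_bounds(1)[OF \<alpha>] by auto
      then show False
        using affine_root_nonzero[OF _ \<alpha>, of z "- height \<alpha>"] by (simp add: affine_root_def)
    qed
  qed
  have "?P = (\<Inter>\<alpha>\<in>\<Sigma>. {x. \<alpha> \<bullet> x < of_int (height \<alpha>)})" by auto
  then have "convex ?P"
    by (simp add: convex_INT convex_halfspace_lt)
  moreover have "?P \<subseteq> - (\<Union>\<alpha>\<in>\<Sigma>. \<Union>k. root_hyperplane \<alpha> k)"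
  proof (clarsimp simp: root_hyperplane_def)
    fix x \<alpha> k assume P: "\<forall>\<alpha>\<in>\<Sigma>. \<alpha> \<bullet> x < of_int (height \<alpha>)" and \<alpha>: "\<alpha> \<in> \<Sigma>"
      and 0: "\<alpha> \<bullet> x + of_int k = 0"
    have "\<alpha> \<bullet> x < of_int (height \<alpha>)" "- (\<alpha> \<bullet> x) < 1 - of_int (height \<alpha>)"
      using P \<alpha> root_minus[OF \<alpha>] base_bounds(3)[OF \<alpha>] by force+
    with 0 have "real_of_int (- k) < of_int (height \<alpha>)" "real_of_int (height \<alpha> - 1) < of_int (- k)"
      by (simp_all add: field_simps)
    then show False unfolding of_int_less_iff by linarith
  qed
  moreover have "base \<in> ?P" using base_bounds(1) by blast
  ultimately show "?P \<subseteq> C"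
    using components_maximal[OF alcove_C[unfolded alcoves_def] convex_connected] base_in by blast
qed

lemma alcove_memI: "(\<And>\<alpha>. \<alpha> \<in> \<Sigma> \<Longrightarrow> \<alpha> \<bullet> x < of_int (height \<alpha>)) \<Longrightarrow> x \<in> C"
  using alcove_eq by blast

lemma alcove_less: "x \<in> C \<Longrightarrow> \<alpha> \<in> \<Sigma> \<Longrightarrow> \<alpha> \<bullet> x < of_int (height \<alpha>)"
  using alcove_eq by blast

lemma alcove_greater:
  assumes "x \<in> C" "\<alpha> \<in> \<Sigma>"
  shows "of_int (height \<alpha>) - 1 < \<alpha> \<bullet> x"
  using alcove_less[OF assms(1) root_minus[OF assms(2)]] base_bounds(3)[OF assms(2)] by simp

lemma alcove_open: "open C"
proof -
  have "C = (\<Inter>\<alpha>\<in>\<Sigma>. {x. \<alpha> \<bullet> x < of_int (height \<alpha>)})" using alcove_eq by auto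
  also have "open \<dots>"
    using finite_roots by (intro open_INT) (auto simp: open_halfspace_lt)
  finally show ?thesis .
qed

text \<open>Since \<alpha> stays inside a unit interval with integer ends, the sign on the alcove is
  decided by the integer \<open>height \<alpha> + k\<close>.\<close>

lemma affine_root_same_sign:
  assumes "\<alpha> \<in> \<Sigma>" "x \<in> C" "y \<in> C"
  shows "0 < affine_root \<alpha> k x \<longleftrightarrow> 0 < affine_root \<alpha> k y"
proof -
  have "0 < affine_root \<alpha> k z \<longleftrightarrow> 1 \<le> height \<alpha> + k" if "z \<in> C" for z
  proof -
    have *: "\<alpha> \<bullet> z < of_int (height \<alpha>)" "of_int (height \<alpha>) - 1 < \<alpha> \<bullet> z"
      using alcove_less[OF that assms(1)] alcove_greater[OF that assms(1)] .
    show ?thesis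
    proof (cases "1 \<le> height \<alpha> + k")
      case True
      then have "(1::real) \<le> of_int (height \<alpha>) + of_int k" by linarith
      with * True show ?thesis by (simp add: affine_root_def)
    next
      case False
      then have "of_int (height \<alpha>) + of_int k \<le> (0::real)" by linarith
      with * False show ?thesis by (simp add: affine_root_def)
    qed
  qed
  then show ?thesis using assms by blast
qed

lemma alcove_closure: "closure C = {x. \<forall>\<alpha>\<in>\<Sigma>. \<alpha> \<bullet> x \<le> of_int (height \<alpha>)}" (is "_ = ?P")
proof
  have "?P = (\<Inter>\<alpha>\<in>\<Sigma>. {x. \<alpha> \<bullet> x \<le> of_int (height \<alpha>)})" by auto
  then have "closed ?P" by (simp add: closed_INT closed_halfspace_le)
  moreover have "C \<subseteq> ?P" using alcove_less less_imp_le by blast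
  ultimately show "closure C \<subseteq> ?P" by (simp add: closure_minimal)
  show "?P \<subseteq> closure C"
  proof
    fix x assume x: "x \<in> ?P"
    show "x \<in> closure C"
    proof (rule in_closure_segmentI)
      fix t :: real assume t: "0 < t" "t < 1"
      show "x + t *\<^sub>R (base - x) \<in> C"
      proof (rule alcove_memI)
        fix \<alpha> assume \<alpha>: "\<alpha> \<in> \<Sigma>"
        have "(1 - t) * (\<alpha> \<bullet> x) + t * (\<alpha> \<bullet> base)
            < (1 - t) * of_int (height \<alpha>) + t * of_int (height \<alpha>)"
          using x \<alpha> t base_bounds(1)[OF \<alpha>] by (intro add_le_less_mono mult_left_mono) auto
        then show "\<alpha> \<bullet> (x + t *\<^sub>R (base - x)) < of_int (height \<alpha>)"
          by (simp add: inner_add_right inner_diff_right algebra_simps)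
      qed
    qed
  qed
qed

text \<open>Roots are used as outward normals of the walls.\<close>

definition wall_roots :: "'a set" where
  "wall_roots = {\<alpha> \<in> \<Sigma>. wall C (root_hyperplane \<alpha> (- height \<alpha>))}"

definition wall_reflection :: "'a \<Rightarrow> 'a \<Rightarrow> 'a" where
  "wall_reflection \<alpha> = affine_reflection \<alpha> (- height \<alpha>)"

lemma wall_rootsD: "\<alpha> \<in> wall_roots \<Longrightarrow> \<alpha> \<in> \<Sigma>"
  by (simp add: wall_roots_def)

lemma wall_value_neg: "\<alpha> \<in> \<Sigma> \<Longrightarrow> x \<in> C \<Longrightarrow> affine_root \<alpha> (- height \<alpha>) x < 0"
  using alcove_less by (simp add: affine_root_def)

lemma affine_root_minus: "affine_root (- \<alpha>) (- k) x = - affine_root \<alpha> k x"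
  by (simp add: affine_root_def)

lemma affine_reflection_minus:
  "\<alpha> \<noteq> 0 \<Longrightarrow> affine_reflection (- \<alpha>) (- k) = affine_reflection \<alpha> k"
  by (rule affine_reflection_scale[of "-1"]) (auto simp: affine_root_def)

lemma root_hyperplane_minus: "root_hyperplane (- \<alpha>) (- k) = root_hyperplane \<alpha> k"
  by (auto simp: root_hyperplane_iff affine_root_minus)

text \<open>A wall touches the closed alcove, where \<alpha> runs between
  \<open>height \<alpha> - 1\<close> and \<open>height \<alpha>\<close>, so the integer
  \<open>- k\<close> is one of the two ends. The two cases say which of \<alpha> and
  \<open>- \<alpha>\<close> points outward.\<close>

lemma wall_cases:
  assumes "\<alpha> \<in> \<Sigma>" "wall C (root_hyperplane \<alpha> k)"
  obtains "\<alpha> \<in> wall_roots" "k = - height \<alpha>" | "- \<alpha> \<in> wall_roots" "- k = - height (- \<alpha>)"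
proof -
  have "root_hyperplane \<alpha> k \<inter> closure C \<noteq> {}"
    using assms(2) root_hyperplane_nonempty[OF root_nonzero[OF assms(1)], of k]
    unfolding wall_def by (metis affine_hull_empty)
  then obtain x where "\<alpha> \<bullet> x + of_int k = 0" "x \<in> closure C"
    by (auto simp: root_hyperplane_def)
  moreover from this(2) have "\<alpha> \<bullet> x \<le> of_int (height \<alpha>)" "of_int (height \<alpha>) - 1 \<le> \<alpha> \<bullet> x"
    unfolding alcove_closure
    using assms(1) root_minus[OF assms(1)] base_bounds(3)[OF assms(1)] by force+
  ultimately have "real_of_int (- k) \<le> of_int (height \<alpha>)" "real_of_int (height \<alpha> - 1) \<le> of_int (- k)"
    by auto
  then have "k = - height \<alpha> \<or> - k = - height (- \<alpha>)"
    unfolding of_int_le_iff using base_bounds(3)[OF assms(1)] by linarith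
  then show ?thesis
  proof
    assume "k = - height \<alpha>"
    then show ?thesis using assms that(1) by (simp add: wall_roots_def)
  next
    assume k: "- k = - height (- \<alpha>)"
    have "wall C (root_hyperplane (- \<alpha>) (- k))"
      using assms(2) by (simp only: root_hyperplane_minus)
    then show ?thesis using k assms root_minus that(2) by (auto simp: wall_roots_def)
  qed
qed

lemma Delta_eq: "\<Delta>_aff \<Sigma> C = wall_reflection ` wall_roots"
proof (intro equalityI subsetI)
  fix s assume "s \<in> \<Delta>_aff \<Sigma> C"
  then obtain \<alpha> k where s: "\<alpha> \<in> \<Sigma>" "wall C (root_hyperplane \<alpha> k)" "s = affine_reflection \<alpha> k"
    by (auto simp: \<Delta>_aff_def)
  from s(1,2) show "s \<in> wall_reflection ` wall_roots"
  proof (cases rule: wall_cases)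
    case 1
    then show ?thesis using s(3) by (auto simp: wall_reflection_def)
  next
    case 2
    then have "s = wall_reflection (- \<alpha>)"
      using s affine_reflection_minus[OF root_nonzero[OF s(1)], of k] by (simp add: wall_reflection_def)
    then show ?thesis using 2 by blast
  qed
qed (auto simp: wall_reflection_def wall_roots_def \<Delta>_aff_def)

lemma finite_Delta: "finite (\<Delta>_aff \<Sigma> C)"
  unfolding Delta_eq wall_roots_def using finite_roots by auto

text \<open>Take a set \<open>F\<close> of roots of least size whose inequalities cut out the closed
  alcove. Dropping a member \<alpha> admits a point \<open>y\<close> that violates only the
  inequality of \<alpha>. The segment from \<open>base\<close> to \<open>y\<close> then crosses the
  hyperplane of \<alpha> where all other inequalities of \<open>F\<close> are strict, so the
  hyperplane is a wall.\<close>

lemma closure_alcove_walls: "closure C = {x. \<forall>\<alpha>\<in>wall_roots. \<alpha> \<bullet> x \<le> of_int (height \<alpha>)}"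
proof -
  let ?P = "\<lambda>F. {x. \<forall>\<alpha>\<in>F. \<alpha> \<bullet> x \<le> of_int (height \<alpha>)}"
  define Q where "Q F \<longleftrightarrow> F \<subseteq> \<Sigma> \<and> ?P F = ?P \<Sigma>" for F
  have "Q \<Sigma>" by (simp add: Q_def)
  then obtain F where "Q F" and min: "\<And>F'. Q F' \<Longrightarrow> card F \<le> card F'"
    using ex_has_least_nat[of Q \<Sigma> card] by blast
  then have F: "F \<subseteq> \<Sigma>" "?P F = ?P \<Sigma>" by (simp_all add: Q_def)
  have "finite F" using F(1) finite_roots finite_subset by blast
  have "F \<subseteq> wall_roots"
  proof
    fix \<alpha> assume \<alpha>: "\<alpha> \<in> F"
    then have \<alpha>\<Sigma>: "\<alpha> \<in> \<Sigma>" using F(1) by blast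
    have "card (F - {\<alpha>}) < card F" using \<alpha> \<open>finite F\<close> by (rule card_Diff1_less[rotated])
    then have "?P (F - {\<alpha>}) \<noteq> ?P F"
      using min[of "F - {\<alpha>}"] F by (auto simp: Q_def)
    moreover have "?P F \<subseteq> ?P (F - {\<alpha>})" by blast
    ultimately obtain y where "y \<in> ?P (F - {\<alpha>})" "y \<notin> ?P F" by blast
    then have y: "\<And>\<beta>. \<beta> \<in> F - {\<alpha>} \<Longrightarrow> \<beta> \<bullet> y \<le> of_int (height \<beta>)"
      "of_int (height \<alpha>) < \<alpha> \<bullet> y"
      by (auto simp: not_le) (metis Diff_iff not_le singletonD)
    \<comment> \<open>The parameter at which the segment from \<open>base\<close> to
      \<open>y\<close> meets the hyperplane of \<alpha>.\<close>
    define t where "t = (of_int (height \<alpha>) - \<alpha> \<bullet> base) / (\<alpha> \<bullet> y - \<alpha> \<bullet> base)"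
    have ab: "\<alpha> \<bullet> base < of_int (height \<alpha>)" using base_bounds(1)[OF \<alpha>\<Sigma>] .
    have t: "0 < t" "t < 1"
      using ab y(2) by (auto simp: t_def)
    define x where "x = (1 - t) *\<^sub>R base + t *\<^sub>R y"
    have "t * (\<alpha> \<bullet> y - \<alpha> \<bullet> base) = of_int (height \<alpha>) - \<alpha> \<bullet> base"
      using ab y(2) by (simp add: t_def)
    then have x\<alpha>: "\<alpha> \<bullet> x = of_int (height \<alpha>)"
      by (simp add: x_def inner_add_right algebra_simps)
    have x\<beta>: "\<beta> \<bullet> x < of_int (height \<beta>)" if "\<beta> \<in> F - {\<alpha>}" for \<beta>
    proof -
      have "\<beta> \<in> \<Sigma>" using that F(1) by blast
      have "(1 - t) * (\<beta> \<bullet> base) + t * (\<beta> \<bullet> y)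
          < (1 - t) * of_int (height \<beta>) + t * of_int (height \<beta>)"
        using t base_bounds(1)[OF \<open>\<beta> \<in> \<Sigma>\<close>] y(1)[OF that]
        by (intro add_less_le_mono mult_left_mono) auto
      then show ?thesis by (simp add: x_def inner_add_right algebra_simps)
    qed
    let ?H = "root_hyperplane \<alpha> (- height \<alpha>)"
    let ?T = "\<Inter>\<beta>\<in>F - {\<alpha>}. {x. \<beta> \<bullet> x < of_int (height \<beta>)}"
    have H: "?H = {x. \<alpha> \<bullet> x = of_int (height \<alpha>)}" by (auto simp: root_hyperplane_def)
    have "affine ?H" unfolding H by (rule affine_hyperplane)
    have "open ?T" using \<open>finite F\<close> by (intro open_INT) (auto simp: open_halfspace_lt)
    have "x \<in> ?H \<inter> ?T" using x\<alpha> x\<beta> by (simp add: H)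
    \<comment> \<open>A non-empty relatively open part of a hyperplane spans it, and this part lies
      in the closed alcove.\<close>
    then have "affine hull (?H \<inter> ?T) = ?H"
      using affine_hull_affine_Int_open[OF \<open>affine ?H\<close> \<open>open ?T\<close>]
        affine_hull_eq[THEN iffD2, OF \<open>affine ?H\<close>] by (metis empty_iff)
    moreover have "?H \<inter> ?T \<subseteq> ?P F" unfolding H by force
    then have "?H \<inter> ?T \<subseteq> ?H \<inter> closure C"
      using alcove_closure F(2) by simp
    then have "affine hull (?H \<inter> ?T) \<subseteq> affine hull (?H \<inter> closure C)"
      by (rule hull_mono)
    ultimately have "?H \<subseteq> affine hull (?H \<inter> closure C)"
      by simp
    moreover have "affine hull (?H \<inter> closure C) \<subseteq> ?H"
      by (rule hull_minimal) (use \<open>affine ?H\<close> in auto)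
    ultimately show "\<alpha> \<in> wall_roots" using \<alpha>\<Sigma> by (auto simp: wall_roots_def wall_def)
  qed
  then have "?P wall_roots \<subseteq> ?P F" "?P \<Sigma> \<subseteq> ?P wall_roots"
    using wall_rootsD by blast+
  then show ?thesis using F(2) alcove_closure by simp
qed

text \<open>The alcove is bounded, so a ray leaving it must cross a wall.\<close>

lemma exists_wall_root:
  assumes "u \<noteq> 0"
  shows "\<exists>\<alpha>\<in>wall_roots. 0 < \<alpha> \<bullet> u"
proof (rule ccontr)
  assume "\<not> ?thesis"
  then have neg: "\<alpha> \<bullet> u \<le> 0" if "\<alpha> \<in> wall_roots" for \<alpha> using that by (auto simp: not_less)
  have ray: "base + t *\<^sub>R u \<in> closure C" if "0 \<le> t" for t
    unfolding closure_alcove_walls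
  proof (intro CollectI ballI)
    fix \<alpha> assume \<alpha>: "\<alpha> \<in> wall_roots"
    have "t * (\<alpha> \<bullet> u) \<le> 0" using that neg[OF \<alpha>] by (simp add: mult_nonneg_nonpos)
    then show "\<alpha> \<bullet> (base + t *\<^sub>R u) \<le> of_int (height \<alpha>)"
      using base_bounds(1)[OF wall_rootsD[OF \<alpha>]] by (simp add: inner_add_right)
  qed
  have le: "\<alpha> \<bullet> u \<le> 0" if \<alpha>: "\<alpha> \<in> \<Sigma>" for \<alpha>
  proof (rule ccontr)
    assume pos: "\<not> \<alpha> \<bullet> u \<le> 0"
    \<comment> \<open>Over this time \<alpha> grows by 1, the width of the strip containing the
      closed alcove. As \<open>base\<close> lies strictly above the lower edge, the ray has left the
      strip.\<close>
    define t where "t = 1 / (\<alpha> \<bullet> u)"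
    have "0 \<le> t" "t * (\<alpha> \<bullet> u) = 1" using pos by (auto simp: t_def)
    then show False
      using ray[of t] \<alpha> base_bounds(2)[OF \<alpha>] by (auto simp: alcove_closure inner_add_right)
  qed
  have "\<alpha> \<bullet> u = 0" if "\<alpha> \<in> \<Sigma>" for \<alpha>
    using le[OF that] le[OF root_minus[OF that]] by simp
  then have "orthogonal u x" if "x \<in> span \<Sigma>" for x
    using orthogonal_to_span[OF that, of u] by (simp add: orthogonal_def inner_commute)
  then have "u \<bullet> u = 0" unfolding span_roots orthogonal_def by blast
  then show False using assms by simp
qed

text \<open>At a point of the face in the wall of \<alpha> the reflection acts trivially, so the
  affine root of \<beta> and its pullback agree there. A non-zero common value would determine the
  same sign at \<open>base\<close> for both, against \<open>sep\<close>. So \<beta> vanishes on the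
  face, hence on its affine span, which is the wall.\<close>

lemma hyperplane_separates_only_wall:
  assumes \<alpha>: "\<alpha> \<in> wall_roots" and \<beta>: "\<beta> \<in> \<Sigma>"
    and sep: "0 < affine_root \<beta> j base \<longleftrightarrow> \<not> 0 < affine_root \<beta> j (wall_reflection \<alpha> base)"
  shows "affine_reflection \<beta> j = wall_reflection \<alpha>"
proof -
  let ?s = "wall_reflection \<alpha>" and ?f = "affine_root \<beta> j"
  have \<alpha>0: "\<alpha> \<noteq> 0" and \<beta>0: "\<beta> \<noteq> 0" using \<alpha> \<beta> wall_rootsD root_nonzero by blast+
  have pt: "?f x = 0" if "affine_root \<alpha> (- height \<alpha>) x = 0" "x \<in> closure C" for x
  proof (rule ccontr)
    assume nz: "?f x \<noteq> 0"
    obtain \<gamma> i where \<gamma>: "\<gamma> \<in> \<Sigma>" "\<And>x. ?f (?s x) = affine_root \<gamma> i x"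
      using affine_root_comp_reflection[OF wall_rootsD[OF \<alpha>] \<beta>] unfolding wall_reflection_def by metis
    have sx: "?s x = x" using that(1) by (simp add: wall_reflection_def affine_reflection_fix)
    \<comment> \<open>A non-zero value at a point of the closure has the sign that the affine root
      has throughout the alcove.\<close>
    have eq: "0 < affine_root \<delta> l base \<longleftrightarrow> 0 < affine_root \<delta> l x"
      if "\<delta> \<in> \<Sigma>" "affine_root \<delta> l x \<noteq> 0" for \<delta> l
    proof -
      have cl: "affine_root \<delta> l x \<in> closure (affine_root \<delta> l ` C)"
        using \<open>x \<in> closure C\<close> image_closure_subset[of C "affine_root \<delta> l" "closure (affine_root \<delta> l ` C)"]
          closure_subset continuous_affine_root by blast
      show ?thesis
      proof (cases "0 < affine_root \<delta> l base")
        case True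
        then have "affine_root \<delta> l ` C \<subseteq> {0..}"
          using affine_root_same_sign[OF that(1) base_in] by fastforce
        then have "closure (affine_root \<delta> l ` C) \<subseteq> {0..}" by (simp add: closure_minimal)
        then show ?thesis using cl that(2) True by force
      next
        case False
        then have "affine_root \<delta> l ` C \<subseteq> {..0}"
          using affine_root_same_sign[OF that(1) base_in] by fastforce
        then have "closure (affine_root \<delta> l ` C) \<subseteq> {..0}" by (simp add: closure_minimal)
        then show ?thesis using cl that(2) False by force
      qed
    qed
    have "affine_root \<gamma> i x = ?f x" using \<gamma>(2)[of x] sx by simp
    then have "0 < ?f (?s base) \<longleftrightarrow> 0 < ?f base"
      using eq[OF \<gamma>(1), of i] eq[OF \<beta> nz] nz \<gamma>(2)[of base] by simp
    then show False using sep by blast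
  qed
  have "root_hyperplane \<alpha> (- height \<alpha>) \<inter> closure C \<subseteq> root_hyperplane \<beta> j"
    using pt by (auto simp: root_hyperplane_iff)
  moreover have "affine (root_hyperplane \<beta> j)"
  proof -
    have "root_hyperplane \<beta> j = {x. \<beta> \<bullet> x = - of_int j}" by (auto simp: root_hyperplane_def)
    then show ?thesis by (simp add: affine_hyperplane)
  qed
  ultimately have "root_hyperplane \<alpha> (- height \<alpha>) \<subseteq> root_hyperplane \<beta> j"
    using \<alpha> hull_minimal unfolding wall_roots_def wall_def by blast
  then have "\<beta> \<bullet> x + of_int j = 0" if "affine_root \<alpha> (- height \<alpha>) x = 0" for x
    using that by (auto simp: root_hyperplane_iff affine_root_def)
  then have eq: "?f x = (\<beta> \<bullet> \<alpha>) / (\<alpha> \<bullet> \<alpha>) * affine_root \<alpha> (- height \<alpha>) x" for x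
    using affine_functional_multiple[OF \<alpha>0, of "- height \<alpha>" \<beta> "of_int j" x]
    unfolding affine_root_def[of \<beta> j] by blast
  moreover have "(\<beta> \<bullet> \<alpha>) / (\<alpha> \<bullet> \<alpha>) \<noteq> 0"
    using affine_root_not_const[OF \<beta>0, of j] eq by (metis mult_zero_left)
  ultimately show ?thesis
    unfolding wall_reflection_def using affine_reflection_scale[OF _ \<alpha>0] by blast
qed

end

section \<open>Words, exchange and length\<close>

definition word_prod :: "('a \<Rightarrow> 'a) list \<Rightarrow> 'a \<Rightarrow> 'a" where
  "word_prod ss = foldr (\<circ>) ss id"

lemma word_prod_simps [simp]: "word_prod [] = id" "word_prod (s # ss) = s \<circ> word_prod ss"
  by (simp_all add: word_prod_def)

text \<open>Products without inverses: the generators used are involutions, so this is already the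
  group they generate.\<close>

definition words :: "('a \<Rightarrow> 'a) set \<Rightarrow> ('a \<Rightarrow> 'a) set" where
  "words S = {word_prod ss | ss. set ss \<subseteq> S}"

lemma word_prod_append: "word_prod (xs @ ys) = word_prod xs \<circ> word_prod ys"
  by (induction xs) (auto simp: comp_assoc)

lemma words_comp: "f \<in> words S \<Longrightarrow> g \<in> words S \<Longrightarrow> f \<circ> g \<in> words S"
  unfolding words_def
  by (clarsimp, rule_tac x="ss @ ssa" in exI) (simp add: word_prod_append)

lemma words_id: "id \<in> words S"
  unfolding words_def by (auto intro!: exI[of _ "[]"])

lemma words_base: "s \<in> S \<Longrightarrow> s \<in> words S"
  unfolding words_def by (auto intro!: exI[of _ "[s]"])

lemma coxeter_length_le: "set ss \<subseteq> S \<Longrightarrow> coxeter_length S (word_prod ss) \<le> length ss"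
  unfolding coxeter_length_def word_prod_def[symmetric] by (rule Least_le) blast

lemma coxeter_length_word:
  assumes "w \<in> words S"
  obtains ss where "set ss \<subseteq> S" "length ss = coxeter_length S w" "w = word_prod ss"
proof -
  have "\<exists>n ss. set ss \<subseteq> S \<and> length ss = n \<and> w = word_prod ss"
    using assms by (auto simp: words_def)
  from LeastI_ex[OF this] show ?thesis
    using that unfolding coxeter_length_def word_prod_def[symmetric] by blast
qed

lemma coxeter_length_comp_le:
  assumes "f \<in> words S" "g \<in> words S"
  shows "coxeter_length S (f \<circ> g) \<le> coxeter_length S f + coxeter_length S g"
proof -
  obtain xs where "set xs \<subseteq> S" "length xs = coxeter_length S f" "f = word_prod xs"
    using coxeter_length_word[OF assms(1)] by blast
  moreover obtain ys where "set ys \<subseteq> S" "length ys = coxeter_length S g" "g = word_prod ys"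
    using coxeter_length_word[OF assms(2)] by blast
  ultimately show ?thesis
    using coxeter_length_le[of "xs @ ys" S] unfolding word_prod_append by simp
qed

lemma coxeter_length_generator: "s \<in> S \<Longrightarrow> coxeter_length S s \<le> 1"
  using coxeter_length_le[of "[s]" S] by simp

lemma finite_coxeter_length_le:
  assumes "finite S"
  shows "finite {w \<in> words S. coxeter_length S w \<le> n}"
proof (rule finite_subset)
  show "{w \<in> words S. coxeter_length S w \<le> n}
      \<subseteq> (\<lambda>ss. word_prod ss) ` {ss. set ss \<subseteq> S \<and> length ss \<le> n}"
  proof clarsimp
    fix w assume "w \<in> words S" "coxeter_length S w \<le> n"
    then obtain ss where "set ss \<subseteq> S" "length ss = coxeter_length S w" "w = word_prod ss"
      using coxeter_length_word by blast
    then show "w \<in> (\<lambda>ss. word_prod ss) ` {ss. set ss \<subseteq> S \<and> length ss \<le> n}"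
      using \<open>coxeter_length S w \<le> n\<close> by auto
  qed
qed (intro finite_imageI finite_lists_length_le assms)

section \<open>The group of affine transformations\<close>

lemma group_affine_group: "group (affine_group :: ('a::euclidean_space \<Rightarrow> 'a) monoid)"
proof (rule groupI)
  fix f g :: "'a \<Rightarrow> 'a"
  assume "f \<in> carrier affine_group" "g \<in> carrier affine_group"
  then obtain A b A' b' where "bij f" "linear A" "f = (\<lambda>x. A x + b)"
    "bij g" "linear A'" "g = (\<lambda>x. A' x + b')" by (auto simp: affine_group_def)
  then have "bij (f \<circ> g)" "linear (A \<circ> A')" "f \<circ> g = (\<lambda>x. (A \<circ> A') x + (A b' + b))"
    by (auto simp: bij_comp linear_compose linear_add)
  then show "f \<otimes>\<^bsub>affine_group\<^esub> g \<in> carrier affine_group"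
    by (auto simp: affine_group_def intro!: exI[of _ "A \<circ> A'"])
next
  fix f :: "'a \<Rightarrow> 'a" assume "f \<in> carrier affine_group"
  then obtain A b where f: "bij f" "linear A" "f = (\<lambda>x. A x + b)"
    by (auto simp: affine_group_def)
  have "A = (\<lambda>x. x - b) \<circ> f" using f(3) by auto
  then have "bij A" using f(1) bij_comp bij_diff_right by metis
  have lin: "linear (inv_into UNIV A)"
    by (rule inj_linear_imp_inv_linear[OF f(2) bij_is_inj[OF \<open>bij A\<close>]])
  let ?g = "\<lambda>y. inv_into UNIV A y + inv_into UNIV A (- b)"
  have "?g (f x) = x" for x
    using \<open>bij A\<close> by (simp add: f(3) linear_add[OF lin, symmetric] bij_is_inj)
  then have "?g \<circ> f = id" by auto
  then have "?g = inv_into UNIV f"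
    using f(1) by (metis bij_is_surj comp_assoc comp_id id_comp surj_iff)
  then have "bij ?g" using bij_imp_bij_inv[OF f(1)] by metis
  then show "\<exists>g\<in>carrier affine_group. g \<otimes>\<^bsub>affine_group\<^esub> f = \<one>\<^bsub>affine_group\<^esub>"
    using lin \<open>?g \<circ> f = id\<close> by (intro bexI[of _ ?g]) (auto simp: affine_group_def)
next
  have "linear (id :: 'a \<Rightarrow> 'a)" "id = (\<lambda>x::'a. id x + 0)" by (auto simp: linear_id)
  then have "\<exists>A b. linear A \<and> id = (\<lambda>x::'a. A x + b)" by blast
  then show "\<one>\<^bsub>affine_group\<^esub> \<in> carrier (affine_group :: ('a \<Rightarrow> 'a) monoid)"
    by (simp add: affine_group_def)
qed (auto simp: affine_group_def comp_assoc)

lemma affine_group_one: "\<one>\<^bsub>affine_group\<^esub> = id"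
  and affine_group_mult: "f \<otimes>\<^bsub>affine_group\<^esub> g = f \<circ> g"
  by (simp_all add: affine_group_def)

lemma inv_affine_group:
  assumes "f \<in> carrier affine_group"
  shows "inv\<^bsub>affine_group\<^esub> f = inv_into UNIV f"
proof -
  interpret group affine_group by (rule group_affine_group)
  have "bij f" using assms by (simp add: affine_group_def)
  have "f \<circ> inv\<^bsub>affine_group\<^esub> f = id"
    using r_inv[OF assms] by (simp add: affine_group_def)
  then show ?thesis
    using \<open>bij f\<close> by (metis bij_is_inj comp_assoc comp_id id_comp inj_iff)
qed

lemma conjugate_affine_group:
  "f \<in> carrier affine_group \<Longrightarrow> conjugate affine_group f g = f \<circ> g \<circ> inv_into UNIV f"
  by (simp add: conjugate_def inv_affine_group) (simp add: affine_group_def)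

lemma affine_isometry_in_affine_group: "affine_isometry f \<Longrightarrow> f \<in> carrier affine_group"
  using affine_isometry_bij[of f]
  by (auto simp: affine_group_def affine_isometry_def orthogonal_transformation_def)

section \<open>Generation by wall reflections, exchange and length\<close>

lemma finite_ints_abs_add_less: "finite {i::int. \<bar>x + of_int i\<bar> < (r::real)}"
proof (rule finite_subset)
  show "{i::int. \<bar>x + of_int i\<bar> < r} \<subseteq> {\<lfloor>- r - x\<rfloor>..\<lceil>r - x\<rceil>}"
  proof clarsimp
    fix i :: int assume "\<bar>x + of_int i\<bar> < r"
    then have "- r - x < of_int i" "of_int i < r - x" by linarith+
    then show "\<lfloor>- r - x\<rfloor> \<le> i \<and> i \<le> \<lceil>r - x\<rceil>" by linarith
  qed
qed simp

context root_alcove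
begin

abbreviation cox :: "('a \<Rightarrow> 'a) \<Rightarrow> nat" where "cox \<equiv> coxeter_length (\<Delta>_aff \<Sigma> C)"

lemma wall_reflection_involution: "\<alpha> \<in> wall_roots \<Longrightarrow> wall_reflection \<alpha> \<circ> wall_reflection \<alpha> = id"
  unfolding wall_reflection_def using affine_reflection_comp_self root_nonzero wall_rootsD by blast

text \<open>Conjugating by a suitable wall reflection makes the absolute value of the affine root at
  \<open>base\<close> smaller. Only finitely many affine roots have absolute value below a given
  bound there, so counting them gives a well-founded measure.\<close>

lemma affine_reflection_in_words:
  assumes "\<beta> \<in> \<Sigma>"
  shows "affine_reflection \<beta> j \<in> words (\<Delta>_aff \<Sigma> C)"
  using assms
proof (induction "card {(\<gamma>, i). \<gamma> \<in> \<Sigma> \<and> \<bar>affine_root \<gamma> i base\<bar> < \<bar>affine_root \<beta> j base\<bar>}"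
    arbitrary: \<beta> j rule: less_induct)
  case (less \<beta> j)
  let ?M = "\<lambda>r. {(\<gamma>, i). \<gamma> \<in> \<Sigma> \<and> \<bar>affine_root \<gamma> i base\<bar> < r}"
  have fin: "finite (?M r)" for r
  proof (rule finite_subset)
    show "?M r \<subseteq> Sigma \<Sigma> (\<lambda>\<gamma>. {i. \<bar>\<gamma> \<bullet> base + of_int i\<bar> < r})"
      by (auto simp: affine_root_def)
  qed (use finite_roots finite_ints_abs_add_less in auto)
  let ?f = "affine_root \<beta> j"
  have f0: "?f base \<noteq> 0" using affine_root_nonzero[OF base_in less.prems] .
  then have "(- ?f base) *\<^sub>R \<beta> \<noteq> 0" using root_nonzero[OF less.prems] by simp
  \<comment> \<open>The sign condition says that reflecting \<open>base\<close> across the wall of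
    \<alpha>, which adds a positive multiple \<open>c\<close> of \<alpha>, moves the value of the
    affine root towards 0.\<close>
  then obtain \<alpha> where \<alpha>: "\<alpha> \<in> wall_roots" and neg: "?f base * (\<alpha> \<bullet> \<beta>) < 0"
    using exists_wall_root by fastforce
  let ?s = "wall_reflection \<alpha>"
  have \<alpha>\<Sigma>: "\<alpha> \<in> \<Sigma>" and \<alpha>0: "\<alpha> \<noteq> 0" using \<alpha> wall_rootsD root_nonzero by auto
  have s\<Delta>: "?s \<in> words (\<Delta>_aff \<Sigma> C)" using \<alpha> by (auto simp: Delta_eq intro: words_base)
  show ?case
  proof (cases "affine_reflection \<beta> j = ?s")
    case False
    then have same: "0 < ?f base \<longleftrightarrow> 0 < ?f (?s base)"
      using hyperplane_separates_only_wall[OF \<alpha> less.prems, of j] by blast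
    obtain \<gamma> i where \<gamma>: "\<gamma> \<in> \<Sigma>" "\<And>x. ?f (?s x) = affine_root \<gamma> i x"
      using affine_root_comp_reflection[OF \<alpha>\<Sigma> less.prems] unfolding wall_reflection_def by metis
    have sf0: "?f (?s base) \<noteq> 0" using affine_root_nonzero[OF base_in \<gamma>(1)] by (simp add: \<gamma>(2))
    define c where "c = - affine_root \<alpha> (- height \<alpha>) base * (2 / (\<alpha> \<bullet> \<alpha>))"
    have "0 < c" using wall_value_neg[OF \<alpha>\<Sigma> base_in] \<alpha>0
      by (simp add: c_def divide_neg_pos)
    have "?f (?s base) = ?f base + c * (\<alpha> \<bullet> \<beta>)"
      by (simp add: wall_reflection_def affine_reflection_eq c_def coroot_def)
        (simp add: affine_root_def inner_diff_right inner_add_right inner_commute)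
    moreover have "(0 < ?f base \<and> c * (\<alpha> \<bullet> \<beta>) < 0) \<or> (?f base < 0 \<and> 0 < c * (\<alpha> \<bullet> \<beta>))"
      using neg \<open>0 < c\<close> by (simp add: mult_less_0_iff zero_less_mult_iff)
    \<comment> \<open>The value moves towards 0 and, since \<open>base\<close> and its reflection
      lie on the same side, does not pass it; so its absolute value drops.\<close>
    ultimately have lt: "\<bar>affine_root \<gamma> i base\<bar> < \<bar>?f base\<bar>"
      using same sf0 unfolding \<gamma>(2) by linarith
    then have "?M \<bar>affine_root \<gamma> i base\<bar> \<subset> ?M \<bar>?f base\<bar>"
      using \<gamma>(1) by force
    then have "card (?M \<bar>affine_root \<gamma> i base\<bar>) < card (?M \<bar>?f base\<bar>)"
      using fin psubset_card_mono by blast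
    then have IH: "affine_reflection \<gamma> i \<in> words (\<Delta>_aff \<Sigma> C)"
      using less.hyps \<gamma>(1) by blast
    have conj: "affine_reflection \<beta> j (?s x) = ?s (affine_reflection \<gamma> i x)" for x
      using affine_reflection_conj[of ?s 1 \<gamma> \<beta> j i] affine_isometry_reflection[OF \<alpha>0]
        root_nonzero[OF \<gamma>(1)] \<gamma>(2) by (simp add: wall_reflection_def)
    have ss: "?s (?s x) = x" for x
      by (simp add: wall_reflection_def affine_reflection_involution[OF \<alpha>0])
    have "affine_reflection \<beta> j x = (?s \<circ> (affine_reflection \<gamma> i \<circ> ?s)) x" for x
      using conj[of "?s x"] by (simp add: ss)
    then have "affine_reflection \<beta> j = ?s \<circ> (affine_reflection \<gamma> i \<circ> ?s)" by blast
    then show ?thesis using s\<Delta> IH by (metis words_comp)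
  qed (use s\<Delta> in simp)
qed

text \<open>\<open>coxeter_length\<close> is a \<open>LEAST\<close> over words in the wall
  reflections; it is meaningful on all of \<open>W_aff\<close> only because every element has such a
  word.\<close>

lemma W_aff_eq_words: "W_aff \<Sigma> = words (\<Delta>_aff \<Sigma> C)"
proof
  let ?R = "{affine_reflection \<alpha> k | \<alpha> k. \<alpha> \<in> \<Sigma>}"
  show "W_aff \<Sigma> \<subseteq> words (\<Delta>_aff \<Sigma> C)"
  proof
    fix w assume "w \<in> W_aff \<Sigma>"
    then show "w \<in> words (\<Delta>_aff \<Sigma> C)"
      unfolding W_aff_def
    proof (induction rule: generate.induct)
      case one
      show ?case unfolding affine_group_one by (rule words_id)
    next
      case (incl h)
      then show ?case using affine_reflection_in_words by auto
    next
      case (inv h)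
      then obtain \<alpha> k where h: "\<alpha> \<in> \<Sigma>" "h = affine_reflection \<alpha> k" by blast
      then have "h \<in> carrier affine_group"
        using affine_isometry_in_affine_group affine_isometry_reflection root_nonzero by blast
      moreover have "h \<circ> h = id" using h affine_reflection_comp_self root_nonzero by blast
      ultimately have "inv\<^bsub>affine_group\<^esub> h = h"
        using group.inv_equality[OF group_affine_group, of h h] by (simp add: affine_group_def)
      then show ?case using h affine_reflection_in_words by simp
    next
      case (eng h1 h2)
      then show ?case unfolding affine_group_mult by (intro words_comp)
    qed
  qed
  have "word_prod ss \<in> generate affine_group ?R" if "set ss \<subseteq> \<Delta>_aff \<Sigma> C" for ss
    using that
  proof (induction ss)
    case Nil
    show ?case using generate.one[of affine_group ?R] unfolding affine_group_one word_prod_simps .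
  next
    case (Cons s ss)
    then have "s \<in> generate affine_group ?R"
      by (intro generate.incl) (auto simp: \<Delta>_aff_def)
    moreover have "word_prod ss \<in> generate affine_group ?R" using Cons by auto
    ultimately have "s \<circ> word_prod ss \<in> generate affine_group ?R"
      using generate.eng[of s affine_group ?R] unfolding affine_group_mult by blast
    then show ?case by (simp add: comp_def)
  qed
  then show "words (\<Delta>_aff \<Sigma> C) \<subseteq> W_aff \<Sigma>" by (auto simp: words_def W_aff_def)
qed

lemma Delta_subset_W_aff: "\<Delta>_aff \<Sigma> C \<subseteq> W_aff \<Sigma>"
  unfolding W_aff_eq_words using words_base by blast

lemma affine_reflection_in_W_aff: "\<alpha> \<in> \<Sigma> \<Longrightarrow> affine_reflection \<alpha> k \<in> W_aff \<Sigma>"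
  unfolding W_aff_eq_words by (rule affine_reflection_in_words)

lemma W_aff_comp: "f \<in> W_aff \<Sigma> \<Longrightarrow> g \<in> W_aff \<Sigma> \<Longrightarrow> f \<circ> g \<in> W_aff \<Sigma>"
  unfolding W_aff_eq_words by (rule words_comp)

lemma W_aff_id: "id \<in> W_aff \<Sigma>"
  unfolding W_aff_eq_words by (rule words_id)

lemma W_aff_induct [consumes 1, case_names id step]:
  assumes "w \<in> W_aff \<Sigma>" "P id"
    and step: "\<And>\<alpha> w. \<alpha> \<in> wall_roots \<Longrightarrow> w \<in> W_aff \<Sigma> \<Longrightarrow> P w \<Longrightarrow> P (wall_reflection \<alpha> \<circ> w)"
  shows "P w"
proof -
  have "set ss \<subseteq> \<Delta>_aff \<Sigma> C \<Longrightarrow> P (word_prod ss)" for ss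
  proof (induction ss)
    case (Cons s ss)
    then obtain \<alpha> where "\<alpha> \<in> wall_roots" "s = wall_reflection \<alpha>" by (auto simp: Delta_eq)
    moreover have "word_prod ss \<in> W_aff \<Sigma>"
      unfolding W_aff_eq_words words_def using Cons.prems by auto
    moreover have "P (word_prod ss)" using Cons by auto
    ultimately have "P (s \<circ> word_prod ss)" using step by blast
    then show ?case by (simp add: comp_def)
  next
    case Nil
    show ?case using assms(2) unfolding word_prod_simps .
  qed
  then show ?thesis using assms(1) unfolding W_aff_eq_words words_def by auto
qed

lemma W_aff_isometry: "w \<in> W_aff \<Sigma> \<Longrightarrow> affine_isometry w"
proof (induction rule: W_aff_induct)
  case (step \<alpha> w)
  then have "affine_isometry (wall_reflection \<alpha>)"
    unfolding wall_reflection_def using affine_isometry_reflection root_nonzero wall_rootsD by blast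
  from affine_isometry_comp[OF this step(3)] show ?case by (simp add: comp_def)
qed (rule affine_isometry_id)

lemma affine_root_comp_W_aff:
  assumes "w \<in> W_aff \<Sigma>" "\<beta> \<in> \<Sigma>"
  obtains \<gamma> i where "\<gamma> \<in> \<Sigma>" "\<And>x. affine_root \<beta> j (w x) = affine_root \<gamma> i x"
proof -
  have "\<exists>\<gamma>\<in>\<Sigma>. \<exists>i. \<forall>x. affine_root \<beta> j (w x) = affine_root \<gamma> i x"
    using assms
  proof (induction arbitrary: \<beta> j rule: W_aff_induct)
    case (step \<alpha> w)
    obtain \<gamma> i where \<gamma>: "\<gamma> \<in> \<Sigma>" "\<And>x. affine_root \<beta> j (wall_reflection \<alpha> x) = affine_root \<gamma> i x"
      using affine_root_comp_reflection[OF wall_rootsD[OF step(1)] step(4)]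
      unfolding wall_reflection_def by metis
    then show ?case using step(3)[OF \<gamma>(1)] by simp
  qed auto
  then show ?thesis using that by blast
qed

lemma affine_root_W_aff_nonzero:
  "w \<in> W_aff \<Sigma> \<Longrightarrow> \<beta> \<in> \<Sigma> \<Longrightarrow> x \<in> C \<Longrightarrow> affine_root \<beta> j (w x) \<noteq> 0"
  by (metis affine_root_comp_W_aff affine_root_nonzero)

lemma affine_root_W_aff_same_sign:
  "w \<in> W_aff \<Sigma> \<Longrightarrow> \<beta> \<in> \<Sigma> \<Longrightarrow> x \<in> C \<Longrightarrow> y \<in> C \<Longrightarrow>
    0 < affine_root \<beta> j (w x) \<longleftrightarrow> 0 < affine_root \<beta> j (w y)"
  by (metis affine_root_comp_W_aff affine_root_same_sign)

text \<open>The strong exchange condition: the gallery of a word crosses every hyperplane that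
  separates its ends, and the letter at a crossing can be deleted.\<close>

lemma exchange:
  assumes "set ss \<subseteq> \<Delta>_aff \<Sigma> C" "\<beta> \<in> \<Sigma>"
    and "0 < affine_root \<beta> j base \<longleftrightarrow> \<not> 0 < affine_root \<beta> j (word_prod ss base)"
  shows "\<exists>ss'. set ss' \<subseteq> \<Delta>_aff \<Sigma> C \<and> length ss' < length ss \<and>
    affine_reflection \<beta> j \<circ> word_prod ss = word_prod ss'"
  using assms
proof (induction ss arbitrary: \<beta> j)
  case (Cons s ss)
  obtain \<alpha> where \<alpha>: "\<alpha> \<in> wall_roots" and s: "s = wall_reflection \<alpha>"
    using Cons.prems(1) by (auto simp: Delta_eq)
  have \<alpha>\<Sigma>: "\<alpha> \<in> \<Sigma>" and \<alpha>0: "\<alpha> \<noteq> 0" using \<alpha> wall_rootsD root_nonzero by auto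
  let ?w = "word_prod ss"
  have ss: "s (s x) = x" for x
    by (simp add: s wall_reflection_def affine_reflection_involution[OF \<alpha>0])
  show ?case
  proof (cases "affine_reflection \<beta> j = s")
    case True
    then have "affine_reflection \<beta> j \<circ> word_prod (s # ss) = word_prod ss"
      using ss by auto
    moreover have "set ss \<subseteq> \<Delta>_aff \<Sigma> C" "length ss < length (s # ss)"
      using Cons.prems(1) by auto
    ultimately show ?thesis by blast
  next
    case False
    then have same: "0 < affine_root \<beta> j base \<longleftrightarrow> 0 < affine_root \<beta> j (s base)"
      using hyperplane_separates_only_wall[OF \<alpha> Cons.prems(2), of j] unfolding s by blast
    obtain \<gamma> i where \<gamma>: "\<gamma> \<in> \<Sigma>" "\<And>x. affine_root \<beta> j (s x) = affine_root \<gamma> i x"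
      using affine_root_comp_reflection[OF \<alpha>\<Sigma> Cons.prems(2)] unfolding s wall_reflection_def by metis
    \<comment> \<open>The first letter does not cross the hyperplane; pulled back along
      \<open>s\<close>, the hyperplane separates the ends of the shorter gallery.\<close>
    have "0 < affine_root \<gamma> i base \<longleftrightarrow> \<not> 0 < affine_root \<gamma> i (?w base)"
      using Cons.prems(3) same \<gamma>(2) by simp
    moreover have "set ss \<subseteq> \<Delta>_aff \<Sigma> C" using Cons.prems(1) by simp
    ultimately obtain ss' where ss': "set ss' \<subseteq> \<Delta>_aff \<Sigma> C" "length ss' < length ss"
      "affine_reflection \<gamma> i \<circ> ?w = word_prod ss'"
      using Cons.IH[OF _ \<gamma>(1), of i] unfolding comp_def by blast
    have conj: "affine_reflection \<beta> j (s x) = s (affine_reflection \<gamma> i x)" for x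
      using affine_reflection_conj[of s 1 \<gamma> \<beta> j i] affine_isometry_reflection[OF \<alpha>0]
        root_nonzero[OF \<gamma>(1)] \<gamma>(2) by (simp add: s wall_reflection_def)
    have "affine_reflection \<beta> j \<circ> word_prod (s # ss) = s \<circ> (affine_reflection \<gamma> i \<circ> ?w)"
      using conj by auto
    also have "\<dots> = word_prod (s # ss')" using ss'(3) by simp
    finally have "affine_reflection \<beta> j \<circ> word_prod (s # ss) = word_prod (s # ss')" .
    moreover have "set (s # ss') \<subseteq> \<Delta>_aff \<Sigma> C" "length (s # ss') < length (s # ss)"
      using ss' Cons.prems(1) by auto
    ultimately show ?thesis by blast
  qed
qed simp

text \<open>Two test points of the alcove are allowed because the lemma is applied with
  \<open>b\<close> as one and \<open>\<psi> \<tau> b\<close> as the other; signs do not depend on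
  the choice.\<close>

lemma cox_reflection_less:
  assumes "w \<in> W_aff \<Sigma>" "\<beta> \<in> \<Sigma>" "x \<in> C" "y \<in> C"
    and "0 < affine_root \<beta> j x \<longleftrightarrow> \<not> 0 < affine_root \<beta> j (w y)"
  shows "cox (affine_reflection \<beta> j \<circ> w) < cox w"
proof -
  obtain ss where ss: "set ss \<subseteq> \<Delta>_aff \<Sigma> C" "length ss = cox w" "w = word_prod ss"
    using coxeter_length_word assms(1) unfolding W_aff_eq_words by blast
  have "0 < affine_root \<beta> j base \<longleftrightarrow> \<not> 0 < affine_root \<beta> j (w base)"
    using assms affine_root_same_sign[OF assms(2,3) base_in]
      affine_root_W_aff_same_sign[OF assms(1,2,4) base_in] by simp
  then obtain ss' where "set ss' \<subseteq> \<Delta>_aff \<Sigma> C" "length ss' < length ss"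
    "affine_reflection \<beta> j \<circ> w = word_prod ss'"
    using exchange[OF ss(1) assms(2)] ss(3) by blast
  then show ?thesis
    using coxeter_length_le[of ss' "\<Delta>_aff \<Sigma> C"] ss(2) by simp
qed

lemma cox_reflection_greater:
  assumes "w \<in> W_aff \<Sigma>" "\<beta> \<in> \<Sigma>" "x \<in> C" "y \<in> C"
    and "0 < affine_root \<beta> j x \<longleftrightarrow> 0 < affine_root \<beta> j (w y)"
  shows "cox w < cox (affine_reflection \<beta> j \<circ> w)"
proof -
  let ?r = "affine_reflection \<beta> j"
  have \<beta>0: "\<beta> \<noteq> 0" using root_nonzero assms(2) .
  have "?r \<circ> w \<in> W_aff \<Sigma>" by (intro W_aff_comp affine_reflection_in_W_aff assms)
  moreover have "0 < affine_root \<beta> j x \<longleftrightarrow> \<not> 0 < affine_root \<beta> j ((?r \<circ> w) y)"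
    using assms(5) affine_root_W_aff_nonzero[OF assms(1,2,4), of j]
    by (auto simp: affine_root_reflection[OF \<beta>0])
  ultimately have "cox (?r \<circ> (?r \<circ> w)) < cox (?r \<circ> w)"
    using cox_reflection_less[OF _ assms(2-4)] by blast
  then show ?thesis
    by (simp add: comp_assoc[symmetric] affine_reflection_comp_self[OF \<beta>0])
qed

lemma cox_generator_comp_le:
  assumes "s \<in> \<Delta>_aff \<Sigma> C" "w \<in> W_aff \<Sigma>"
  shows "cox (s \<circ> w) \<le> cox w + 1" "cox (w \<circ> s) \<le> cox w + 1"
  using coxeter_length_comp_le[of s "\<Delta>_aff \<Sigma> C" w] coxeter_length_comp_le[of w "\<Delta>_aff \<Sigma> C" s]
    coxeter_length_generator[OF assms(1)] words_base[OF assms(1)] assms(2)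
  unfolding W_aff_eq_words by auto

text \<open>The stabilizer of a point \<open>v\<close> of the closed alcove is generated by the wall
  reflections fixing \<open>v\<close>. If a shortest word of \<open>w\<close> starts with
  \<open>s\<close>, then \<open>w\<close> carries the closed alcove to the far side of the wall of
  \<open>s\<close>. Since \<open>v\<close> lies in the closed alcove and in its image, it lies on
  the wall, so \<open>s\<close> fixes \<open>v\<close> and can be split off.\<close>

lemma stabilizer_induct [consumes 3, case_names id step]:
  assumes "w \<in> W_aff \<Sigma>" "w v = v" "v \<in> closure C" "P id"
    and step: "\<And>\<alpha> w. \<alpha> \<in> wall_roots \<Longrightarrow> wall_reflection \<alpha> v = v \<Longrightarrow> w \<in> W_aff \<Sigma> \<Longrightarrow> w v = v \<Longrightarrow>
      P w \<Longrightarrow> P (wall_reflection \<alpha> \<circ> w)"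
  shows "P w"
  using assms(1,2)
proof (induction "cox w" arbitrary: w rule: less_induct)
  case less
  obtain ss where ss: "set ss \<subseteq> \<Delta>_aff \<Sigma> C" "length ss = cox w" "w = word_prod ss"
    using coxeter_length_word less.prems(1) unfolding W_aff_eq_words by blast
  show ?case
  proof (cases ss)
    case Nil
    then show ?thesis using ss(3) assms(4) by simp
  next
    case (Cons s ts)
    then obtain \<alpha> where \<alpha>: "\<alpha> \<in> wall_roots" and s: "s = wall_reflection \<alpha>"
      using ss(1) by (auto simp: Delta_eq)
    have \<alpha>\<Sigma>: "\<alpha> \<in> \<Sigma>" and \<alpha>0: "\<alpha> \<noteq> 0" using \<alpha> wall_rootsD root_nonzero by auto
    let ?f = "affine_root \<alpha> (- height \<alpha>)"
    have sw: "s \<circ> w = word_prod ts"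
      using ss(3) Cons wall_reflection_involution[OF \<alpha>] by (auto simp: s fun_eq_iff)
    have lt: "cox (s \<circ> w) < cox w"
      using coxeter_length_le[of ts "\<Delta>_aff \<Sigma> C"] ss Cons sw by auto
    then have pos: "0 < ?f (w base)"
      using cox_reflection_greater[OF less.prems(1) \<alpha>\<Sigma> base_in base_in, of "- height \<alpha>"]
        wall_value_neg[OF \<alpha>\<Sigma> base_in] by (auto simp: s wall_reflection_def)
    obtain \<gamma> i where \<gamma>: "\<gamma> \<in> \<Sigma>" "\<And>x. ?f (w x) = affine_root \<gamma> i x"
      using affine_root_comp_W_aff[OF less.prems(1) \<alpha>\<Sigma>] by metis
    have "?f ` C \<subseteq> {..0}" using wall_value_neg[OF \<alpha>\<Sigma>] by fastforce
    then have "?f ` closure C \<subseteq> {..0}"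
      by (rule image_closure_subset[OF continuous_affine_root closed_atMost])
    moreover have "affine_root \<gamma> i ` C \<subseteq> {0..}"
      using affine_root_same_sign[OF \<gamma>(1) base_in] pos unfolding \<gamma>(2) by fastforce
    then have "affine_root \<gamma> i ` closure C \<subseteq> {0..}"
      by (rule image_closure_subset[OF continuous_affine_root closed_atLeast])
    ultimately have "?f v \<le> 0" "0 \<le> ?f v"
      using assms(3) \<gamma>(2)[of v] less.prems(2) by auto
    then have "?f v = 0" by simp
    then have sv: "s v = v" by (simp add: s wall_reflection_def affine_reflection_fix)
    have "s \<in> \<Delta>_aff \<Sigma> C" using \<alpha> s by (auto simp: Delta_eq)
    then have "s \<circ> w \<in> W_aff \<Sigma>" using Delta_subset_W_aff less.prems(1) W_aff_comp by blast
    then have "P (s \<circ> w)" using less.hyps[OF lt] less.prems(2) sv by simp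
    then have "P (s \<circ> (s \<circ> w))"
      unfolding s using step[OF \<alpha>] \<open>s \<circ> w \<in> W_aff \<Sigma>\<close> less.prems(2) sv by (simp add: s)
    then show ?thesis
      using wall_reflection_involution[OF \<alpha>] by (simp add: s comp_assoc[symmetric])
  qed
qed

end

section \<open>Displacement of isometries\<close>

text \<open>The vector \<open>2 b - X b - X\<inverse> b\<close> is half the gradient at \<open>b\<close> of the squared
  displacement \<open>\<parallel>X b - b\<parallel>\<^sup>2\<close>.\<close>

lemma displacement_increase:
  fixes X X' :: "'a::euclidean_space \<Rightarrow> 'a"
  assumes X: "affine_isometry X" "X (X' b) = b" and "\<alpha> \<noteq> 0" "affine_root \<alpha> k b < 0"
    and pos: "0 < \<alpha> \<bullet> (2 *\<^sub>R b - X b - X' b)"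
  shows "norm (X b - b)
    < norm (X (affine_reflection \<alpha> k b) - affine_reflection \<alpha> k b)"
proof -
  obtain A d where A: "linear A" "\<And>x. X x = A x + d" "\<And>x y. A x \<bullet> A y = x \<bullet> y"
    using affine_isometry_linear_part[OF X(1)] by metis
  define c where "c = - affine_root \<alpha> k b * (2 / (\<alpha> \<bullet> \<alpha>))"
  have "0 < c" using assms(3,4) by (simp add: c_def divide_neg_pos)
  have s: "affine_reflection \<alpha> k b = b + c *\<^sub>R \<alpha>"
    by (simp add: affine_reflection_eq c_def coroot_def)
  \<comment> \<open>\<open>c *\<^sub>R E\<close> is the change of the displacement vector; its
    quadratic contribution is non-negative, so the sign of the first-order term decides.\<close>
  define E where "E = A \<alpha> - \<alpha>"
  have diff: "X (affine_reflection \<alpha> k b) - affine_reflection \<alpha> k b = (X b - b) + c *\<^sub>R E"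
    by (simp add: s A(2) linear_add[OF A(1)] linear_scale[OF A(1)] E_def algebra_simps)
  \<comment> \<open>Writing the displacement as an image under \<open>A\<close> lets
    \<open>A\<close> cancel against the one on \<alpha>; this is how \<open>X' b\<close> enters the
    gradient.\<close>
  have "X b - b = A (b - X' b)"
    using X(2) by (simp add: A(2) linear_diff[OF A(1)] algebra_simps)
  then have "(X b - b) \<bullet> A \<alpha> = (b - X' b) \<bullet> \<alpha>" by (simp add: A(3))
  then have "(X b - b) \<bullet> E = \<alpha> \<bullet> (2 *\<^sub>R b - X b - X' b)"
    by (simp add: E_def inner_diff_right inner_diff_left inner_commute)
  then have "0 < c * ((X b - b) \<bullet> E)" using pos \<open>0 < c\<close> by simp
  then have "(X b - b) \<bullet> (X b - b) < (X b - b) \<bullet> (X b - b) + 2 * (c * ((X b - b) \<bullet> E)) + c * c * (E \<bullet> E)"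
    using \<open>0 < c\<close> inner_ge_zero[of E] by (smt (verit) mult_nonneg_nonneg)
  also have "\<dots> = ((X b - b) + c *\<^sub>R E) \<bullet> ((X b - b) + c *\<^sub>R E)"
    by (simp add: inner_add_left inner_add_right inner_commute algebra_simps)
  finally show ?thesis unfolding diff by (simp add: norm_lt)
qed

text \<open>The gradient is an affine function of \<open>b\<close>, so vanishing on an open set
  kills its linear part: \<open>2 h = A h + A' h\<close> with \<open>A'\<close> inverse to
  \<open>A\<close>. Pairing with \<open>h\<close> gives \<open>norm (h - A h) = 0\<close>, so
  \<open>A\<close> is the identity and \<open>X\<close> a translation.\<close>

lemma exists_displacement_gradient_nonzero:
  fixes X X' :: "'a::euclidean_space \<Rightarrow> 'a"
  assumes X: "affine_isometry X" "affine_isometry X'" "\<And>a. X (X' a) = a"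
    and ntrans: "\<nexists>v. \<forall>a. X a = a + v" and U: "open U" "U \<noteq> {}"
  shows "\<exists>b\<in>U. 2 *\<^sub>R b - X b - X' b \<noteq> 0"
proof (rule ccontr)
  assume "\<not> ?thesis"
  then have zero: "2 *\<^sub>R b - X b - X' b = 0" if "b \<in> U" for b using that by blast
  obtain A d where A: "linear A" "\<And>x. X x = A x + d" "\<And>x y. A x \<bullet> A y = x \<bullet> y"
    using affine_isometry_linear_part[OF X(1)] by metis
  obtain A' d' where A': "linear A'" "\<And>x. X' x = A' x + d'"
    using affine_isometry_linear_part[OF X(2)] by metis
  have AA': "A (A' h) = h" for h
  proof -
    have "A (A' h) + (A d' + d) = h" for h
      using X(3)[of h] by (simp add: A(2) A'(2) linear_add[OF A(1)] add.assoc)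
    from this[of h] this[of 0] show ?thesis
      by (simp add: linear_0[OF A(1)] linear_0[OF A'(1)])
  qed
  obtain b where "b \<in> U" using U(2) by blast
  then obtain e where "0 < e" "ball b e \<subseteq> U" using U(1) open_contains_ball by blast
  have small: "A h = h" if "norm h < e" for h
  proof -
    have "b + h \<in> U" using that \<open>ball b e \<subseteq> U\<close> by (auto simp: dist_norm)
    then have "2 *\<^sub>R h - A h - A' h = 0"
      using zero[OF \<open>b \<in> U\<close>] zero[of "b + h"]
      by (simp add: A(2) A'(2) linear_add[OF A(1)] linear_add[OF A'(1)] algebra_simps)
    then have "h \<bullet> (2 *\<^sub>R h - A h - A' h) = 0" by simp
    moreover have "h \<bullet> A' h = A h \<bullet> h" using A(3)[of h "A' h"] AA' by simp
    ultimately have "(h - A h) \<bullet> (h - A h) = 0"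
      using A(3)[of h h] by (simp add: inner_diff_left inner_diff_right inner_commute)
    then show ?thesis by simp
  qed
  have "A h = h" for h
  proof (cases "h = 0")
    case False
    define c where "c = e / (2 * norm h)"
    have "c \<noteq> 0" "norm (c *\<^sub>R h) < e" using \<open>0 < e\<close> False by (auto simp: c_def)
    then show ?thesis using small[of "c *\<^sub>R h"] by (simp add: linear_scale[OF A(1)])
  qed (simp add: linear_0[OF A(1)])
  then show False using ntrans A(2) by auto
qed

lemma affine_isometry_affine_combination:
  assumes "affine_isometry X" "u + v = 1"
  shows "X (u *\<^sub>R x + v *\<^sub>R y) = u *\<^sub>R X x + v *\<^sub>R X y"
proof -
  obtain A d where A: "linear A" "\<And>x. X x = A x + d"
    using affine_isometry_linear_part[OF assms(1)] by metis
  have "d = (u + v) *\<^sub>R d" using assms(2) by simp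
  then show ?thesis
    by (simp add: A(2) linear_add[OF A(1)] linear_scale[OF A(1)] algebra_simps)
qed

lemma affine_isometry_continuous:
  assumes "affine_isometry X"
  shows "continuous_on S X"
proof -
  obtain A d where A: "linear A" "\<And>x. X x = A x + d"
    using affine_isometry_linear_part[OF assms(1)] by metis
  then show ?thesis
    by (simp add: continuous_on_add linear_continuous_on linear_linear)
qed

section \<open>Quasi-Coxeter groups\<close>

context quasi_coxeter_group
begin

sublocale root_alcove \<Sigma> C
  by (rule root_alcove.intro[OF roots(1) alcove(1)])

abbreviation G :: "(('a \<Rightarrow> 'a) \<times> 'o) monoid" where "G \<equiv> W_tilde \<Sigma> \<Omega> \<psi>"
abbreviation act :: "('a \<Rightarrow> 'a) \<times> 'o \<Rightarrow> 'a \<Rightarrow> 'a" where "act \<equiv> action \<psi>"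
abbreviation gen :: "'a \<Rightarrow> ('a \<Rightarrow> 'a) \<times> 'o" where "gen \<alpha> \<equiv> (wall_reflection \<alpha>, \<one>\<^bsub>\<Omega>\<^esub>)"
abbreviation lth :: "('a \<Rightarrow> 'a) \<times> 'o \<Rightarrow> nat" where "lth \<equiv> len \<Sigma> C"

sublocale O: comm_group \<Omega> by (rule Omega(1))

sublocale G: group G
  using semidirect normal_imp_subgroup unfolding internal_semidirect_def normal_def by blast

lemma carrier_G: "x \<in> carrier G \<longleftrightarrow> fst x \<in> W_aff \<Sigma> \<and> snd x \<in> carrier \<Omega>"
  by (cases x) (simp add: W_tilde_def)

lemma psi_carrier:
  assumes "\<tau> \<in> carrier \<Omega>"
  shows "\<psi> \<tau> \<in> carrier affine_group"
proof -
  have "\<psi> \<tau> \<in> normalizer affine_group (W_aff \<Sigma>)"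
    using psi_hom assms by (auto simp: hom_def)
  then show ?thesis by (simp add: normalizer_def stabilizer_def)
qed

lemma psi_bij: "\<tau> \<in> carrier \<Omega> \<Longrightarrow> bij (\<psi> \<tau>)"
  using psi_carrier by (simp add: affine_group_def)

lemma psi_mult: "\<sigma> \<in> carrier \<Omega> \<Longrightarrow> \<tau> \<in> carrier \<Omega> \<Longrightarrow> \<psi> (\<sigma> \<otimes>\<^bsub>\<Omega>\<^esub> \<tau>) = \<psi> \<sigma> \<circ> \<psi> \<tau>"
  using psi_hom by (simp add: hom_def affine_group_mult)

lemma psi_one: "\<psi> \<one>\<^bsub>\<Omega>\<^esub> = id"
proof -
  have "\<psi> \<one>\<^bsub>\<Omega>\<^esub> \<circ> \<psi> \<one>\<^bsub>\<Omega>\<^esub> = \<psi> \<one>\<^bsub>\<Omega>\<^esub>" using psi_mult[of "\<one>\<^bsub>\<Omega>\<^esub>" "\<one>\<^bsub>\<Omega>\<^esub>"] by simp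
  then show ?thesis
    using bij_is_inj[OF psi_bij[OF O.one_closed]] by (metis comp_assoc id_comp inj_iff)
qed

lemma mult_G:
  assumes "x \<in> carrier G" "y \<in> carrier G"
  shows "x \<otimes>\<^bsub>G\<^esub> y
    = (fst x \<circ> (\<psi> (snd x) \<circ> fst y \<circ> inv_into UNIV (\<psi> (snd x))), snd x \<otimes>\<^bsub>\<Omega>\<^esub> snd y)"
  using assms psi_carrier
  by (cases x, cases y) (simp add: W_tilde_def conjugate_affine_group)

lemma one_G: "\<one>\<^bsub>G\<^esub> = (id, \<one>\<^bsub>\<Omega>\<^esub>)"
  by (simp add: W_tilde_def)

lemma act_mult:
  assumes "x \<in> carrier G" "y \<in> carrier G"
  shows "act (x \<otimes>\<^bsub>G\<^esub> y) a = act x (act y a)"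
  using assms bij_is_inj[OF psi_bij, of "snd x"]
  by (simp add: mult_G action_def carrier_G psi_mult)

lemma act_one: "act \<one>\<^bsub>G\<^esub> a = a"
  by (simp add: one_G action_def psi_one)

lemma act_inv:
  assumes "x \<in> carrier G"
  shows "act x (act (inv\<^bsub>G\<^esub> x) a) = a" "act (inv\<^bsub>G\<^esub> x) (act x a) = a"
  using act_mult[OF assms G.inv_closed[OF assms], of a] act_mult[OF G.inv_closed[OF assms] assms, of a]
    assms by (simp_all add: act_one)

lemma snd_mult: "x \<in> carrier G \<Longrightarrow> y \<in> carrier G \<Longrightarrow> snd (x \<otimes>\<^bsub>G\<^esub> y) = snd x \<otimes>\<^bsub>\<Omega>\<^esub> snd y"
  by (simp add: mult_G)

lemma snd_inv: "x \<in> carrier G \<Longrightarrow> snd (inv\<^bsub>G\<^esub> x) = inv\<^bsub>\<Omega>\<^esub> snd x"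
proof -
  assume x: "x \<in> carrier G"
  have "snd (inv\<^bsub>G\<^esub> x) \<otimes>\<^bsub>\<Omega>\<^esub> snd x = \<one>\<^bsub>\<Omega>\<^esub>"
    using snd_mult[OF G.inv_closed[OF x] x] x by (simp add: one_G)
  then show ?thesis using O.inv_equality x G.inv_closed[OF x] carrier_G by metis
qed

lemma Lambda_carrier: "t \<in> \<Lambda> \<Sigma> \<Omega> \<psi> \<Longrightarrow> t \<in> carrier G"
  by (simp add: \<Lambda>_def)

lemma W_fin_carrier: "g \<in> W_fin \<Sigma> v \<Omega> \<Longrightarrow> g \<in> carrier G"
  by (auto simp: W_fin_def carrier_G)

lemma act_W_fin: "g \<in> W_fin \<Sigma> v \<Omega> \<Longrightarrow> act g = fst g"
  by (auto simp: W_fin_def action_def psi_one)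

text \<open>The decomposition \<open>W_tilde = \<Lambda> \<rtimes> W_fin\<close> is what makes the action isometric.\<close>

lemma act_isometry:
  assumes "x \<in> carrier G"
  shows "affine_isometry (act x)"
proof -
  have "x \<in> \<Lambda> \<Sigma> \<Omega> \<psi> <#>\<^bsub>G\<^esub> W_fin \<Sigma> v \<Omega>"
    using assms semidirect by (simp add: internal_semidirect_def)
  then obtain t g where tg: "t \<in> \<Lambda> \<Sigma> \<Omega> \<psi>" "g \<in> W_fin \<Sigma> v \<Omega>" "x = t \<otimes>\<^bsub>G\<^esub> g"
    by (auto simp: set_mult_def)
  obtain d where d: "\<And>a. act t a = a + d" using tg(1) by (auto simp: \<Lambda>_def)
  have "act x = (\<lambda>a. a + d) \<circ> fst g"
    using act_mult[OF Lambda_carrier[OF tg(1)] W_fin_carrier[OF tg(2)]] d act_W_fin[OF tg(2)]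
    by (auto simp: tg(3))
  moreover have "affine_isometry (fst g)" using tg(2) W_aff_isometry by (auto simp: W_fin_def)
  ultimately show ?thesis
    using affine_isometry_comp[OF affine_isometry_translation] by simp
qed

section \<open>The action of \<open>\<Omega>\<close> on the alcove and its walls\<close>

lemma psi_isometry:
  assumes "\<tau> \<in> carrier \<Omega>"
  shows "affine_isometry (\<psi> \<tau>)"
proof -
  have "(id, \<tau>) \<in> carrier G" using assms W_aff_id by (simp add: carrier_G)
  from act_isometry[OF this] show ?thesis by (simp add: action_def[abs_def])
qed

lemma psi_in_alcove: "\<tau> \<in> carrier \<Omega> \<Longrightarrow> \<psi> \<tau> x \<in> C \<longleftrightarrow> x \<in> C"
  using psi_alcove psi_bij bij_is_inj inj_image_mem_iff by metis

lemma psi_closure_alcove: "\<tau> \<in> carrier \<Omega> \<Longrightarrow> x \<in> closure C \<Longrightarrow> \<psi> \<tau> x \<in> closure C"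
  using image_closure_subset[OF affine_isometry_continuous[OF psi_isometry] closed_closure[of C], of \<tau>]
    psi_alcove closure_subset by blast

text \<open>The image of a face lies in the closed alcove but not in the alcove. By convexity it then
  lies in a single hyperplane bounding the alcove.\<close>

lemma psi_face:
  assumes \<tau>: "\<tau> \<in> carrier \<Omega>" and \<alpha>: "\<alpha> \<in> wall_roots"
  shows "\<exists>\<beta>\<in>\<Sigma>. \<forall>x\<in>root_hyperplane \<alpha> (- height \<alpha>) \<inter> closure C. \<beta> \<bullet> \<psi> \<tau> x = of_int (height \<beta>)"
proof (rule ccontr)
  let ?F = "root_hyperplane \<alpha> (- height \<alpha>) \<inter> closure C"
  assume "\<not> ?thesis"
  then have "\<forall>\<beta>\<in>\<Sigma>. \<exists>x\<in>?F. \<beta> \<bullet> \<psi> \<tau> x \<noteq> of_int (height \<beta>)" by blast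
  then obtain p where p: "\<And>\<beta>. \<beta> \<in> \<Sigma> \<Longrightarrow> p \<beta> \<in> ?F" "\<And>\<beta>. \<beta> \<in> \<Sigma> \<Longrightarrow> \<beta> \<bullet> \<psi> \<tau> (p \<beta>) \<noteq> of_int (height \<beta>)"
    by metis
  obtain A d where A: "linear A" "\<And>x. \<psi> \<tau> x = A x + d"
    using affine_isometry_linear_part[OF psi_isometry[OF \<tau>]] by metis
  have "\<alpha> \<in> \<Sigma>" using \<alpha> wall_rootsD by blast
  define n where "n = real (card \<Sigma>)"
  have "0 < n" using \<open>\<alpha> \<in> \<Sigma>\<close> finite_roots card_gt_0_iff by (auto simp: n_def)
  have sum1: "(\<Sum>\<gamma>\<in>\<Sigma>. 1 / n) = 1" using \<open>0 < n\<close> by (simp add: n_def)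
  \<comment> \<open>The average of one witness for each root: every inequality holds at all
    witnesses and is strict at its own one, so all are strict at the image of
    \<open>y\<close>.\<close>
  define y where "y = (\<Sum>\<gamma>\<in>\<Sigma>. (1 / n) *\<^sub>R p \<gamma>)"
  have cl: "closure C = (\<Inter>\<beta>\<in>\<Sigma>. {x. \<beta> \<bullet> x \<le> of_int (height \<beta>)})" by (auto simp: alcove_closure)
  have H: "root_hyperplane \<alpha> (- height \<alpha>) = {x. \<alpha> \<bullet> x = of_int (height \<alpha>)}"
    by (auto simp: root_hyperplane_def)
  have "convex ?F"
    unfolding H cl by (intro convex_Int convex_hyperplane convex_INT convex_halfspace_le)
  then have "y \<in> ?F"
    unfolding y_def using finite_roots sum1 p(1) \<open>0 < n\<close> by (intro convex_sum) auto
  have "\<psi> \<tau> y \<in> C"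
  proof (rule alcove_memI)
    fix \<beta> assume \<beta>: "\<beta> \<in> \<Sigma>"
    have "d = (\<Sum>\<gamma>\<in>\<Sigma>. (1 / n) *\<^sub>R d)"
      using sum1 by (simp only: scaleR_sum_left[symmetric] scaleR_one)
    then have "\<psi> \<tau> y = (\<Sum>\<gamma>\<in>\<Sigma>. (1 / n) *\<^sub>R \<psi> \<tau> (p \<gamma>))"
      by (simp add: A(2) y_def linear_sum[OF A(1)] linear_scale[OF A(1)] scaleR_add_right sum.distrib)
    then have "\<beta> \<bullet> \<psi> \<tau> y = (\<Sum>\<gamma>\<in>\<Sigma>. (1 / n) * (\<beta> \<bullet> \<psi> \<tau> (p \<gamma>)))"
      by (simp add: inner_sum_right)
    also have "\<dots> < (\<Sum>\<gamma>\<in>\<Sigma>. (1 / n) * of_int (height \<beta>))"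
    proof (rule sum_strict_mono_ex1[OF finite_roots])
      have le: "\<beta> \<bullet> \<psi> \<tau> (p \<gamma>) \<le> of_int (height \<beta>)" if "\<gamma> \<in> \<Sigma>" for \<gamma>
        using psi_closure_alcove[OF \<tau>] p(1)[OF that] \<beta> by (auto simp: alcove_closure)
      then show "\<forall>\<gamma>\<in>\<Sigma>. (1 / n) * (\<beta> \<bullet> \<psi> \<tau> (p \<gamma>)) \<le> (1 / n) * of_int (height \<beta>)"
        using \<open>0 < n\<close> by (auto intro!: mult_left_mono divide_right_mono)
      show "\<exists>\<gamma>\<in>\<Sigma>. (1 / n) * (\<beta> \<bullet> \<psi> \<tau> (p \<gamma>)) < (1 / n) * of_int (height \<beta>)"
        using \<beta> le[OF \<beta>] p(2)[OF \<beta>] \<open>0 < n\<close> by (auto intro!: bexI[of _ \<beta>] divide_strict_right_mono)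
    qed
    also have "\<dots> = of_int (height \<beta>)" by (simp only: sum_distrib_right[symmetric] sum1 mult_1)
    finally show "\<beta> \<bullet> \<psi> \<tau> y < of_int (height \<beta>)" .
  qed
  then have "y \<in> C" using psi_in_alcove[OF \<tau>] by simp
  then show False
    using \<open>y \<in> ?F\<close> affine_root_nonzero[OF _ \<open>\<alpha> \<in> \<Sigma>\<close>] by (auto simp: root_hyperplane_iff)
qed

text \<open>The face of \<alpha> spans its wall, so the hyperplane found by \<open>psi_face\<close>
  contains the image of the whole wall and the two functionals are proportional. Both are negative
  on the alcove, so the factor is positive.\<close>

lemma psi_wall:
  assumes \<tau>: "\<tau> \<in> carrier \<Omega>" and \<alpha>: "\<alpha> \<in> wall_roots"
  obtains \<beta> c where "\<beta> \<in> wall_roots" "0 < c"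
    "\<And>x. affine_root \<beta> (- height \<beta>) (\<psi> \<tau> x) = c * affine_root \<alpha> (- height \<alpha>) x"
    "\<And>x. wall_reflection \<beta> (\<psi> \<tau> x) = \<psi> \<tau> (wall_reflection \<alpha> x)"
proof -
  let ?H = "root_hyperplane \<alpha> (- height \<alpha>)"
  obtain \<beta> where \<beta>: "\<beta> \<in> \<Sigma>" "\<And>x. x \<in> ?H \<inter> closure C \<Longrightarrow> \<beta> \<bullet> \<psi> \<tau> x = of_int (height \<beta>)"
    using psi_face[OF assms] by blast
  let ?K = "root_hyperplane \<beta> (- height \<beta>)"
  have \<alpha>\<Sigma>: "\<alpha> \<in> \<Sigma>" and \<alpha>0: "\<alpha> \<noteq> 0" and \<beta>0: "\<beta> \<noteq> 0"
    using \<alpha> \<beta>(1) wall_rootsD root_nonzero by auto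
  have hullH: "affine hull (?H \<inter> closure C) = ?H" using \<alpha> by (simp add: wall_roots_def wall_def)
  have pre: "affine (\<psi> \<tau> -` S)" if "affine S" for S
    using that by (auto simp: affine_def affine_isometry_affine_combination[OF psi_isometry[OF \<tau>]])
  have "affine ?K"
  proof -
    have "?K = {x. \<beta> \<bullet> x = of_int (height \<beta>)}" by (auto simp: root_hyperplane_def)
    then show ?thesis by (simp add: affine_hyperplane)
  qed
  have face: "\<psi> \<tau> x \<in> ?K \<inter> closure C" if "x \<in> ?H \<inter> closure C" for x
    using \<beta>(2)[OF that] that psi_closure_alcove[OF \<tau>] by (auto simp: root_hyperplane_def)
  have "?H \<subseteq> \<psi> \<tau> -` ?K"
    using hull_minimal[of "?H \<inter> closure C" "\<psi> \<tau> -` ?K" affine] face pre[OF \<open>affine ?K\<close>] hullH by blast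
  obtain A d where A: "linear A" "\<And>x. \<psi> \<tau> x = A x + d" "\<And>x y. A x \<bullet> A y = x \<bullet> y" "surj A"
    using affine_isometry_linear_part[OF psi_isometry[OF \<tau>]] by metis
  obtain u where u: "\<beta> = A u" using A(4) by blast
  have val: "affine_root \<beta> (- height \<beta>) (\<psi> \<tau> x) = u \<bullet> x + (\<beta> \<bullet> d - of_int (height \<beta>))" for x
    by (simp add: affine_root_def A(2) inner_add_right u A(3))
  define c where "c = (u \<bullet> \<alpha>) / (\<alpha> \<bullet> \<alpha>)"
  have c: "affine_root \<beta> (- height \<beta>) (\<psi> \<tau> x) = c * affine_root \<alpha> (- height \<alpha>) x" for x
    unfolding val c_def
  proof (rule affine_functional_multiple[OF \<alpha>0])
    fix x assume "affine_root \<alpha> (- height \<alpha>) x = 0"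
    then have "\<psi> \<tau> x \<in> ?K" using \<open>?H \<subseteq> \<psi> \<tau> -` ?K\<close> by (auto simp: root_hyperplane_iff)
    then show "u \<bullet> x + (\<beta> \<bullet> d - of_int (height \<beta>)) = 0" by (simp add: root_hyperplane_iff val)
  qed
  have "affine_root \<beta> (- height \<beta>) (\<psi> \<tau> base) < 0" "affine_root \<alpha> (- height \<alpha>) base < 0"
    using wall_value_neg \<alpha>\<Sigma> \<beta>(1) base_in psi_in_alcove[OF \<tau>] by auto
  then have "0 < c" by (simp add: c mult_less_0_iff)
  \<comment> \<open>The image of the face of \<alpha> lies in the face of \<beta> and spans the
    hyperplane, which is therefore a wall.\<close>
  have "?K \<subseteq> affine hull (?K \<inter> closure C)"
  proof
    fix y assume "y \<in> ?K"
    obtain x where y: "y = \<psi> \<tau> x" using bij_is_surj[OF psi_bij[OF \<tau>]] by blast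
    then have "x \<in> ?H" using \<open>y \<in> ?K\<close> c[of x] \<open>0 < c\<close> by (simp add: root_hyperplane_iff)
    have "?H \<inter> closure C \<subseteq> \<psi> \<tau> -` (affine hull (?K \<inter> closure C))"
      using face hull_subset by fastforce
    then have "?H \<subseteq> \<psi> \<tau> -` (affine hull (?K \<inter> closure C))"
      using hull_minimal[of "?H \<inter> closure C" _ affine] pre[OF affine_affine_hull] hullH by metis
    then show "y \<in> affine hull (?K \<inter> closure C)" using \<open>x \<in> ?H\<close> y by blast
  qed
  moreover have "affine hull (?K \<inter> closure C) \<subseteq> ?K"
    by (rule hull_minimal) (use \<open>affine ?K\<close> in auto)
  ultimately have "\<beta> \<in> wall_roots" using \<beta>(1) by (simp add: wall_roots_def wall_def)
  moreover have "wall_reflection \<beta> (\<psi> \<tau> x) = \<psi> \<tau> (wall_reflection \<alpha> x)" for x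
    unfolding wall_reflection_def
    using affine_reflection_conj[OF psi_isometry[OF \<tau>] _ \<alpha>0 c] \<open>0 < c\<close> by simp
  ultimately show ?thesis using that \<open>0 < c\<close> c by blast
qed

section \<open>Wall reflections in \<open>W_tilde\<close> and their effect on length\<close>

lemma gen_carrier: "\<alpha> \<in> wall_roots \<Longrightarrow> gen \<alpha> \<in> carrier G"
  using Delta_subset_W_aff by (auto simp: carrier_G Delta_eq)

lemma act_gen: "act (gen \<alpha>) = wall_reflection \<alpha>"
  by (auto simp: action_def psi_one)

lemma gen_mult:
  assumes "\<alpha> \<in> wall_roots" "x \<in> carrier G"
  shows "gen \<alpha> \<otimes>\<^bsub>G\<^esub> x = (wall_reflection \<alpha> \<circ> fst x, snd x)"
  using mult_G[OF gen_carrier[OF assms(1)] assms(2)] assms(2)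
  by (simp add: psi_one carrier_G)

lemma gen_involution: "\<alpha> \<in> wall_roots \<Longrightarrow> gen \<alpha> \<otimes>\<^bsub>G\<^esub> gen \<alpha> = \<one>\<^bsub>G\<^esub>"
  using gen_mult[OF _ gen_carrier] by (simp add: one_G wall_reflection_involution)

lemma gen_gen_mult:
  assumes "\<alpha> \<in> wall_roots" "x \<in> carrier G"
  shows "gen \<alpha> \<otimes>\<^bsub>G\<^esub> (gen \<alpha> \<otimes>\<^bsub>G\<^esub> x) = x" "(x \<otimes>\<^bsub>G\<^esub> gen \<alpha>) \<otimes>\<^bsub>G\<^esub> gen \<alpha> = x"
  using gen_carrier[OF assms(1)] assms(2) gen_involution[OF assms(1)]
  by (simp_all add: G.m_assoc[symmetric]) (simp add: G.m_assoc)

lemma inv_gen: "\<alpha> \<in> wall_roots \<Longrightarrow> inv\<^bsub>G\<^esub> gen \<alpha> = gen \<alpha>"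
  using gen_involution gen_carrier G.inv_equality by blast

lemma mult_gen:
  assumes "\<alpha> \<in> wall_roots" "x \<in> carrier G" "\<beta> \<in> wall_roots"
    and "\<And>a. wall_reflection \<beta> (\<psi> (snd x) a) = \<psi> (snd x) (wall_reflection \<alpha> a)"
  shows "x \<otimes>\<^bsub>G\<^esub> gen \<alpha> = (fst x \<circ> wall_reflection \<beta>, snd x)"
proof -
  have "snd x \<in> carrier \<Omega>" using assms(2) carrier_G by blast
  then have "\<psi> (snd x) \<circ> wall_reflection \<alpha> \<circ> inv_into UNIV (\<psi> (snd x)) = wall_reflection \<beta>"
    by (auto simp: fun_eq_iff assms(4)[symmetric] surj_f_inv_f[OF bij_is_surj[OF psi_bij]])
  then show ?thesis
    using mult_G[OF assms(2) gen_carrier[OF assms(1)]] \<open>snd x \<in> carrier \<Omega>\<close> by simp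
qed

lemma W_aff_inverse:
  assumes "w \<in> W_aff \<Sigma>"
  obtains w' where "w' \<in> W_aff \<Sigma>" "\<And>x. w (w' x) = x" "\<And>x. w' (w x) = x"
proof -
  have x: "(w, \<one>\<^bsub>\<Omega>\<^esub>) \<in> carrier G" using assms by (simp add: carrier_G)
  let ?y = "inv\<^bsub>G\<^esub> (w, \<one>\<^bsub>\<Omega>\<^esub>)"
  have "snd ?y = \<one>\<^bsub>\<Omega>\<^esub>" using snd_inv[OF x] by simp
  then show ?thesis
    using that[of "fst ?y"] act_inv[OF x] G.inv_closed[OF x]
    by (simp add: carrier_G action_def psi_one)
qed

text \<open>Multiplying by \<open>s\<close> on the left lengthens \<open>x\<close> exactly when
  \<open>x b\<close> is on the alcove's side of the wall. Any \<open>b\<close> of the alcove serves;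
  later it is the point at which displacement is measured.\<close>

lemma lth_gen_mult:
  assumes "\<alpha> \<in> wall_roots" "x \<in> carrier G" "b \<in> C"
  shows "affine_root \<alpha> (- height \<alpha>) (act x b) < 0 \<Longrightarrow> lth x < lth (gen \<alpha> \<otimes>\<^bsub>G\<^esub> x)"
    and "\<not> affine_root \<alpha> (- height \<alpha>) (act x b) < 0 \<Longrightarrow> lth (gen \<alpha> \<otimes>\<^bsub>G\<^esub> x) < lth x"
proof -
  let ?f = "affine_root \<alpha> (- height \<alpha>)"
  have \<alpha>\<Sigma>: "\<alpha> \<in> \<Sigma>" using assms(1) wall_rootsD by blast
  have x: "fst x \<in> W_aff \<Sigma>" "snd x \<in> carrier \<Omega>" using assms(2) carrier_G by auto
  then have y: "\<psi> (snd x) b \<in> C" using assms(3) psi_in_alcove by blast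
  have neg: "?f b < 0" using wall_value_neg[OF \<alpha>\<Sigma> assms(3)] .
  have "?f (act x b) \<noteq> 0" unfolding action_def by (rule affine_root_W_aff_nonzero[OF x(1) \<alpha>\<Sigma> y])
  then show "?f (act x b) < 0 \<Longrightarrow> lth x < lth (gen \<alpha> \<otimes>\<^bsub>G\<^esub> x)"
    and "\<not> ?f (act x b) < 0 \<Longrightarrow> lth (gen \<alpha> \<otimes>\<^bsub>G\<^esub> x) < lth x"
    using cox_reflection_greater[OF x(1) \<alpha>\<Sigma> assms(3) y, of "- height \<alpha>"]
      cox_reflection_less[OF x(1) \<alpha>\<Sigma> assms(3) y, of "- height \<alpha>"] neg
    unfolding gen_mult[OF assms(1,2)] len_def
    by (auto simp: wall_reflection_def action_def)
qed

text \<open>Right multiplication by \<open>s\<close> is left multiplication by the reflection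
  \<open>x s x^-1\<close>, whose affine root at \<open>b\<close> is a positive multiple of that of
  \<alpha> at \<open>x^-1 b\<close>. As \<open>s\<close> has to pass the
  \<open>\<Omega>\<close>-component of \<open>x\<close> first, it is replaced by the reflection in
  the wall \<beta>.\<close>

lemma lth_mult_gen:
  assumes "\<alpha> \<in> wall_roots" "x \<in> carrier G" "b \<in> C"
  shows "affine_root \<alpha> (- height \<alpha>) (act (inv\<^bsub>G\<^esub> x) b) < 0 \<Longrightarrow> lth x < lth (x \<otimes>\<^bsub>G\<^esub> gen \<alpha>)"
    and "\<not> affine_root \<alpha> (- height \<alpha>) (act (inv\<^bsub>G\<^esub> x) b) < 0 \<Longrightarrow> lth (x \<otimes>\<^bsub>G\<^esub> gen \<alpha>) < lth x"
    and "lth (x \<otimes>\<^bsub>G\<^esub> gen \<alpha>) \<le> lth x + 1"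
proof -
  let ?f = "affine_root \<alpha> (- height \<alpha>)"
  have \<alpha>\<Sigma>: "\<alpha> \<in> \<Sigma>" using assms(1) wall_rootsD by blast
  have x: "fst x \<in> W_aff \<Sigma>" "snd x \<in> carrier \<Omega>" using assms(2) carrier_G by auto
  then have y: "\<psi> (snd x) b \<in> C" using assms(3) psi_in_alcove by blast
  have neg: "?f b < 0" using wall_value_neg[OF \<alpha>\<Sigma> assms(3)] .
  obtain \<beta> c where \<beta>: "\<beta> \<in> wall_roots" "0 < c"
    "\<And>a. affine_root \<beta> (- height \<beta>) (\<psi> (snd x) a) = c * ?f a"
    "\<And>a. wall_reflection \<beta> (\<psi> (snd x) a) = \<psi> (snd x) (wall_reflection \<alpha> a)"
    using psi_wall[OF x(2) assms(1)] by blast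
  have \<beta>\<Sigma>: "\<beta> \<in> \<Sigma>" using \<beta>(1) wall_rootsD by blast
  have mult: "x \<otimes>\<^bsub>G\<^esub> gen \<alpha> = (fst x \<circ> wall_reflection \<beta>, snd x)"
    by (rule mult_gen[OF assms(1,2) \<beta>(1,4)])
  obtain w' where w': "w' \<in> W_aff \<Sigma>" "\<And>a. fst x (w' a) = a" "\<And>a. w' (fst x a) = a"
    using W_aff_inverse[OF x(1)] by blast
  obtain \<gamma> i where \<gamma>: "\<gamma> \<in> \<Sigma>" "\<And>a. affine_root \<beta> (- height \<beta>) (w' a) = affine_root \<gamma> i a"
    using affine_root_comp_W_aff[OF w'(1) \<beta>\<Sigma>] by metis
  have \<gamma>val: "affine_root \<gamma> i (fst x a) = 1 * affine_root \<beta> (- height \<beta>) a" for a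
    using \<gamma>(2)[of "fst x a"] by (simp add: w'(3))
  have "affine_reflection \<gamma> i (fst x a) = fst x (wall_reflection \<beta> a)" for a
    unfolding wall_reflection_def
    by (rule affine_reflection_conj[OF W_aff_isometry[OF x(1)] _ root_nonzero[OF \<beta>\<Sigma>] \<gamma>val]) simp
  then have mult': "x \<otimes>\<^bsub>G\<^esub> gen \<alpha> = (affine_reflection \<gamma> i \<circ> fst x, snd x)"
    unfolding mult by auto
  have "w' b = \<psi> (snd x) (act (inv\<^bsub>G\<^esub> x) b)"
    using act_inv(1)[OF assms(2), of b] w'(3) unfolding action_def[of \<psi> x] by metis
  then have val: "affine_root \<gamma> i b = c * ?f (act (inv\<^bsub>G\<^esub> x) b)"
    using \<gamma>(2)[of b] \<beta>(3) by simp
  have val2: "affine_root \<gamma> i (fst x (\<psi> (snd x) b)) < 0"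
    unfolding \<gamma>val \<beta>(3) using neg \<beta>(2) by (simp add: mult_pos_neg)
  have "affine_root \<gamma> i b \<noteq> 0" by (rule affine_root_nonzero[OF assms(3) \<gamma>(1)])
  then show "?f (act (inv\<^bsub>G\<^esub> x) b) < 0 \<Longrightarrow> lth x < lth (x \<otimes>\<^bsub>G\<^esub> gen \<alpha>)"
    and "\<not> ?f (act (inv\<^bsub>G\<^esub> x) b) < 0 \<Longrightarrow> lth (x \<otimes>\<^bsub>G\<^esub> gen \<alpha>) < lth x"
    using cox_reflection_greater[OF x(1) \<gamma>(1) assms(3) y, of i]
      cox_reflection_less[OF x(1) \<gamma>(1) assms(3) y, of i] val2 val \<beta>(2)
    by (auto simp: mult' len_def zero_less_mult_iff)
  have "wall_reflection \<beta> \<in> \<Delta>_aff \<Sigma> C" using \<beta>(1) by (simp add: Delta_eq)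
  then show "lth (x \<otimes>\<^bsub>G\<^esub> gen \<alpha>) \<le> lth x + 1"
    using cox_generator_comp_le(2)[OF _ x(1)] by (simp add: mult len_def)
qed

lemma lth_gen_mult_le:
  assumes "\<alpha> \<in> wall_roots" "x \<in> carrier G"
  shows "lth (gen \<alpha> \<otimes>\<^bsub>G\<^esub> x) \<le> lth x + 1"
  using cox_generator_comp_le(1)[of "wall_reflection \<alpha>" "fst x"] assms carrier_G
  by (simp add: gen_mult[OF assms] len_def Delta_eq)

lemma lth_gen_neq:
  assumes "\<alpha> \<in> wall_roots" "x \<in> carrier G"
  shows "lth (gen \<alpha> \<otimes>\<^bsub>G\<^esub> x) \<noteq> lth x" "lth (x \<otimes>\<^bsub>G\<^esub> gen \<alpha>) \<noteq> lth x"
  using lth_gen_mult[OF assms base_in] lth_mult_gen[OF assms base_in] by fastforce+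

text \<open>Pass through the longer neighbour \<open>s x\<close> or \<open>x s\<close>; the second
  multiplication loses at most 1.\<close>

lemma lth_conj_ge:
  assumes "\<alpha> \<in> wall_roots" "x \<in> carrier G"
    and "lth x < lth (gen \<alpha> \<otimes>\<^bsub>G\<^esub> x) \<or> lth x < lth (x \<otimes>\<^bsub>G\<^esub> gen \<alpha>)"
  shows "lth x \<le> lth (gen \<alpha> \<otimes>\<^bsub>G\<^esub> x \<otimes>\<^bsub>G\<^esub> gen \<alpha>)"
  using assms(3)
proof
  note g = gen_carrier[OF assms(1)]
  have y: "gen \<alpha> \<otimes>\<^bsub>G\<^esub> x \<otimes>\<^bsub>G\<^esub> gen \<alpha> \<in> carrier G" "gen \<alpha> \<otimes>\<^bsub>G\<^esub> x \<in> carrier G" "x \<otimes>\<^bsub>G\<^esub> gen \<alpha> \<in> carrier G"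
    using g assms(2) by auto
  {
    assume "lth x < lth (gen \<alpha> \<otimes>\<^bsub>G\<^esub> x)"
    moreover have "lth (gen \<alpha> \<otimes>\<^bsub>G\<^esub> x) \<le> lth (gen \<alpha> \<otimes>\<^bsub>G\<^esub> x \<otimes>\<^bsub>G\<^esub> gen \<alpha>) + 1"
      using lth_mult_gen(3)[OF assms(1) y(1) base_in] gen_gen_mult(2)[OF assms(1) y(2)] by simp
    ultimately show ?thesis by simp
  next
    assume "lth x < lth (x \<otimes>\<^bsub>G\<^esub> gen \<alpha>)"
    moreover have "lth (x \<otimes>\<^bsub>G\<^esub> gen \<alpha>) \<le> lth (gen \<alpha> \<otimes>\<^bsub>G\<^esub> x \<otimes>\<^bsub>G\<^esub> gen \<alpha>) + 1"
      using lth_gen_mult_le[OF assms(1) y(1)] gen_gen_mult(1)[OF assms(1) y(3)] g assms(2)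
      by (simp add: G.m_assoc)
    ultimately show ?thesis by simp
  }
qed

text \<open>If \<open>\<alpha>\<close> has positive inner product with the gradient, the midpoint of \<open>x b\<close> and
  \<open>x\<inverse> b\<close> is further below the wall than \<open>b\<close>, so one of the two points lies
  below the wall, which makes \<open>s x\<close> or \<open>x s\<close> longer than \<open>x\<close>.\<close>

lemma exists_wall_increase:
  assumes x: "x \<in> carrier G" and b: "b \<in> C"
    and grad: "2 *\<^sub>R b - act x b - act (inv\<^bsub>G\<^esub> x) b \<noteq> 0"
  obtains \<alpha> where "\<alpha> \<in> wall_roots"
    "lth x < lth (gen \<alpha> \<otimes>\<^bsub>G\<^esub> x) \<or> lth x < lth (x \<otimes>\<^bsub>G\<^esub> gen \<alpha>)"
    "norm (act x b - b) < norm (act (gen \<alpha> \<otimes>\<^bsub>G\<^esub> x \<otimes>\<^bsub>G\<^esub> gen \<alpha>) b - b)"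
proof -
  obtain \<alpha> where \<alpha>: "\<alpha> \<in> wall_roots"
    and pos: "0 < \<alpha> \<bullet> (2 *\<^sub>R b - act x b - act (inv\<^bsub>G\<^esub> x) b)"
    using exists_wall_root[OF grad] by blast
  let ?f = "affine_root \<alpha> (- height \<alpha>)"
  have \<alpha>\<Sigma>: "\<alpha> \<in> \<Sigma>" and \<alpha>0: "\<alpha> \<noteq> 0" using \<alpha> wall_rootsD root_nonzero by auto
  have neg: "?f b < 0" by (rule wall_value_neg[OF \<alpha>\<Sigma> b])
  have "?f (act x b) + ?f (act (inv\<^bsub>G\<^esub> x) b) < 2 * ?f b"
    using pos by (simp add: affine_root_def inner_diff_right)
  then have "?f (act x b) < 0 \<or> ?f (act (inv\<^bsub>G\<^esub> x) b) < 0" using neg by linarith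
  then have "lth x < lth (gen \<alpha> \<otimes>\<^bsub>G\<^esub> x) \<or> lth x < lth (x \<otimes>\<^bsub>G\<^esub> gen \<alpha>)"
    using lth_gen_mult(1)[OF \<alpha> x b] lth_mult_gen(1)[OF \<alpha> x b] by blast
  moreover have "norm (act x b - b) < norm (act (gen \<alpha> \<otimes>\<^bsub>G\<^esub> x \<otimes>\<^bsub>G\<^esub> gen \<alpha>) b - b)"
  proof -
    let ?s = "wall_reflection \<alpha>"
    \<comment> \<open>The displacement of \<open>s x s\<close> at \<open>b\<close> is that of
      \<open>x\<close> at \<open>s b\<close>, because \<open>s\<close> is an isometric
      involution.\<close>
    have "norm (act x b - b) < norm (act x (?s b) - ?s b)"
      unfolding wall_reflection_def
      by (rule displacement_increase[where X' = "act (inv\<^bsub>G\<^esub> x)", OF act_isometry[OF x]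
            act_inv(1)[OF x] \<alpha>0 neg pos])
    also have "\<dots> = norm (?s (act x (?s b)) - ?s (?s b))"
      unfolding wall_reflection_def
      by (rule affine_isometry_dist[OF affine_isometry_reflection[OF \<alpha>0], symmetric])
    also have "?s (?s b) = b" by (simp add: wall_reflection_def affine_reflection_involution[OF \<alpha>0])
    also have "?s (act x (?s b)) = act (gen \<alpha> \<otimes>\<^bsub>G\<^esub> x \<otimes>\<^bsub>G\<^esub> gen \<alpha>) b"
      using gen_carrier[OF \<alpha>] x by (simp add: act_mult act_gen)
    finally show ?thesis .
  qed
  ultimately show ?thesis using that \<alpha> by blast
qed

text \<open>For a translation by \<open>d\<close> the images of \<open>base\<close> under
  \<open>t\<close> and its inverse are \<open>base + d\<close> and \<open>base - d\<close>. Their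
  midpoint is below every wall, so one of them is; hence here every wall will do.\<close>

lemma translation_increase:
  assumes \<alpha>: "\<alpha> \<in> wall_roots" and t: "t \<in> \<Lambda> \<Sigma> \<Omega> \<psi>"
  shows "lth t < lth (gen \<alpha> \<otimes>\<^bsub>G\<^esub> t) \<or> lth t < lth (t \<otimes>\<^bsub>G\<^esub> gen \<alpha>)"
proof -
  let ?f = "affine_root \<alpha> (- height \<alpha>)"
  have tG: "t \<in> carrier G" using t by (rule Lambda_carrier)
  obtain d where d: "\<And>a. act t a = a + d" using t by (auto simp: \<Lambda>_def)
  have "act (inv\<^bsub>G\<^esub> t) base = base - d"
    using act_inv(1)[OF tG, of base] unfolding d by (simp add: algebra_simps)
  moreover have "?f base < 0" by (rule wall_value_neg[OF wall_rootsD[OF \<alpha>] base_in])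
  ultimately have "?f (act t base) < 0 \<or> ?f (act (inv\<^bsub>G\<^esub> t) base) < 0"
    by (simp add: d affine_root_def inner_add_right inner_diff_right) linarith
  then show ?thesis
    using lth_gen_mult(1)[OF \<alpha> tG base_in] lth_mult_gen(1)[OF \<alpha> tG base_in] by blast
qed

text \<open>Each element excludes a closed set without interior, so the open set can be shrunk once
  per element; the claim is proved for all non-empty open sets to allow this.\<close>

lemma exists_generic_point:
  assumes "finite F" "F \<subseteq> carrier G - \<Lambda> \<Sigma> \<Omega> \<psi>"
  shows "\<exists>b\<in>C. \<forall>x\<in>F. 2 *\<^sub>R b - act x b - act (inv\<^bsub>G\<^esub> x) b \<noteq> 0"
proof -
  have "open U \<Longrightarrow> U \<noteq> {} \<Longrightarrow> \<exists>b\<in>U. \<forall>x\<in>F. 2 *\<^sub>R b - act x b - act (inv\<^bsub>G\<^esub> x) b \<noteq> 0" for U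
    using assms
  proof (induction F arbitrary: U rule: finite_induct)
    case (insert x F)
    have x: "x \<in> carrier G" "\<nexists>v. \<forall>a. act x a = a + v"
      using insert.prems(3) by (auto simp: \<Lambda>_def)
    let ?g = "\<lambda>b. 2 *\<^sub>R b - act x b - act (inv\<^bsub>G\<^esub> x) b"
    let ?U = "U \<inter> {b. ?g b \<noteq> 0}"
    have "continuous_on UNIV ?g"
      by (intro continuous_intros affine_isometry_continuous act_isometry x G.inv_closed)
    then have "open {b. ?g b \<noteq> 0}"
      by (intro open_Collect_neq) auto
    then have "open ?U" using insert.prems(1) by blast
    moreover have "?U \<noteq> {}"
      using exists_displacement_gradient_nonzero[OF act_isometry[OF x(1)]
          act_isometry[OF G.inv_closed[OF x(1)]] act_inv(1)[OF x(1)] x(2) insert.prems(1,2)] by blast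
    ultimately obtain b where "b \<in> ?U" "\<forall>x\<in>F. 2 *\<^sub>R b - act x b - act (inv\<^bsub>G\<^esub> x) b \<noteq> 0"
      using insert.IH[of ?U] insert.prems(3) by blast
    then show ?case by auto
  qed auto
  then show ?thesis using alcove_open alcove_nonempty by blast
qed

text \<open>Fixing the \<open>\<Omega>\<close>-component matters, as \<open>\<Omega>\<close> may be
  infinite and contributes nothing to the length.\<close>

lemma finite_bounded_length: "finite {x \<in> carrier G. lth x \<le> n \<and> snd x = \<tau>}"
proof (rule finite_subset)
  show "{x \<in> carrier G. lth x \<le> n \<and> snd x = \<tau>}
      \<subseteq> {w \<in> words (\<Delta>_aff \<Sigma> C). cox w \<le> n} \<times> {\<tau>}"
    by (auto simp: carrier_G len_def W_aff_eq_words)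
qed (use finite_coxeter_length_le[OF finite_Delta] in auto)

end

section \<open>Central elements of the Hecke algebra\<close>

text \<open>The finite spanning set is part of the conclusion because \<open>dim\<close> takes the
  value 0 on infinite-dimensional spaces.\<close>

lemma (in vector_space) dim_le_card_linear_injective:
  assumes V: "subspace V" and f: "Vector_Spaces.linear scale scale f"
    and inj: "\<And>x. x \<in> V \<Longrightarrow> f x = 0 \<Longrightarrow> x = 0"
    and W: "finite W" "f ` V \<subseteq> span W"
  shows "(\<exists>B. finite B \<and> V \<subseteq> span B) \<and> dim V \<le> card W"
proof -
  interpret f: Vector_Spaces.linear scale scale f by (rule f)
  obtain B where B: "B \<subseteq> V" "independent B" "V \<subseteq> span B" "card B = dim V"
    using basis_exists by blast
  have "span B \<subseteq> V" using B(1) V span_minimal by blast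
  have "inj_on f (span B)"
  proof (rule inj_onI)
    fix x y assume xy: "x \<in> span B" "y \<in> span B" and "f x = f y"
    then have "f (x - y) = 0" by (simp add: f.diff)
    moreover have "x - y \<in> V" using xy \<open>span B \<subseteq> V\<close> V subspace_diff by blast
    ultimately show "x = y" using inj by fastforce
  qed
  then have "independent (f ` B)" by (rule f.independent_injective_image[OF B(2)])
  moreover have "f ` B \<subseteq> span W" using B(1) W(2) by blast
  ultimately have "finite (f ` B) \<and> card (f ` B) \<le> card W"
    using independent_span_bound[OF W(1)] by blast
  moreover have "inj_on f B" using \<open>inj_on f (span B)\<close> span_superset inj_on_subset by blast
  ultimately have "finite B" "card B \<le> card W"
    using finite_imageD card_image by (blast, metis)
  then show ?thesis using B by auto
qed

context hecke_algebra
begin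

abbreviation coef :: "'h \<Rightarrow> ('a \<Rightarrow> 'a) \<times> 'o \<Rightarrow> complex" where
  "coef \<equiv> hcoeff smul T (carrier G)"

lemma in_span_T: "h \<in> H.span (T ` carrier G)"
  using T_basis(3) by simp

lemma coef_add: "coef (h + h') x = coef h x + coef h' x"
  and coef_scale: "coef (smul c h) x = c * coef h x"
  and coef_zero: "coef 0 x = 0"
  unfolding hcoeff_def
  using H.representation_add[OF T_basis(2) in_span_T in_span_T]
    H.representation_scale[OF T_basis(2) in_span_T] H.representation_zero by auto

lemma coef_T:
  assumes "x \<in> carrier G" "y \<in> carrier G"
  shows "coef (T y) x = (if x = y then 1 else 0)"
  unfolding hcoeff_def
  using H.representation_basis[OF T_basis(2), of "T y"] assms T_basis(1) by (auto dest: inj_onD)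

lemma coef_eq_zero:
  assumes "\<And>x. x \<in> carrier G \<Longrightarrow> coef h x = 0"
  shows "h = 0"
proof -
  have "H.representation (T ` carrier G) h b = 0" for b
    using assms H.representation_ne_zero[of "T ` carrier G" h b] unfolding hcoeff_def by blast
  then show ?thesis
    using H.sum_nonzero_representation_eq[OF T_basis(2) in_span_T, of h] by simp
qed

lemma finite_support: "finite {x \<in> carrier G. coef h x \<noteq> 0}"
proof (rule finite_imageD)
  show "finite (T ` {x \<in> carrier G. coef h x \<noteq> 0})"
    by (rule finite_subset[OF _ H.finite_representation[of "T ` carrier G" h]])
      (auto simp: hcoeff_def)
  show "inj_on T {x \<in> carrier G. coef h x \<noteq> 0}"
    using T_basis(1) by (rule inj_on_subset) auto
qed

lemma T_induct [case_names zero step]: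
  assumes "P 0" "\<And>c x h. x \<in> carrier G \<Longrightarrow> P h \<Longrightarrow> P (smul c (T x) + h)"
  shows "P h"
  using in_span_T[of h] by (induction rule: H.span_induct_alt) (use assms in auto)

section \<open>Coefficients of products with generators\<close>

lemma gen_in_Delta: "\<alpha> \<in> wall_roots \<Longrightarrow> wall_reflection \<alpha> \<in> \<Delta>_aff \<Sigma> C"
  by (simp add: Delta_eq)

text \<open>Only the basis elements at \<open>y\<close> and at \<open>s y\<close> can contribute to
  the coefficient at \<open>y\<close>. The two cases are exhaustive because multiplication by a
  generator always changes the length.\<close>

lemma coef_gen_mult:
  assumes \<alpha>: "\<alpha> \<in> wall_roots" and y: "y \<in> carrier G"
  shows "coef (T (gen \<alpha>) * h) y = (if lth (gen \<alpha> \<otimes>\<^bsub>G\<^esub> y) < lth y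
    then coef h (gen \<alpha> \<otimes>\<^bsub>G\<^esub> y) + (of_nat (q (wall_reflection \<alpha>)) - 1) * coef h y
    else of_nat (q (wall_reflection \<alpha>)) * coef h (gen \<alpha> \<otimes>\<^bsub>G\<^esub> y))"
proof (induction h rule: T_induct)
  case zero
  show ?case by (simp add: coef_zero)
next
  case (step c x h)
  let ?g = "gen \<alpha>" and ?q = "of_nat (q (wall_reflection \<alpha>)) :: complex"
  note g = gen_carrier[OF \<alpha>] and \<Delta> = gen_in_Delta[OF \<alpha>]
  have gy: "?g \<otimes>\<^bsub>G\<^esub> y \<in> carrier G" and gx: "?g \<otimes>\<^bsub>G\<^esub> x \<in> carrier G" using g y step(1) by auto
  have swap: "y = ?g \<otimes>\<^bsub>G\<^esub> x \<longleftrightarrow> ?g \<otimes>\<^bsub>G\<^esub> y = x"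
    using gen_gen_mult(1)[OF \<alpha>] y step(1) by metis
  have "coef (T ?g * T x) y = (if lth (?g \<otimes>\<^bsub>G\<^esub> y) < lth y
    then coef (T x) (?g \<otimes>\<^bsub>G\<^esub> y) + (?q - 1) * coef (T x) y
    else ?q * coef (T x) (?g \<otimes>\<^bsub>G\<^esub> y))"
  proof (cases "lth x < lth (?g \<otimes>\<^bsub>G\<^esub> x)")
    case True
    then have "T ?g * T x = T (?g \<otimes>\<^bsub>G\<^esub> x)" by (rule T_left_up[OF \<Delta> step(1)])
    then show ?thesis
      using True swap by (auto simp: coef_T y gy gx step(1))
  next
    case False
    then have lt: "lth (?g \<otimes>\<^bsub>G\<^esub> x) < lth x"
      using lth_gen_neq(1)[OF \<alpha> step(1)] by simp
    have "T ?g * T x = smul (?q - 1) (T x) + smul ?q (T (?g \<otimes>\<^bsub>G\<^esub> x))"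
      by (rule T_left_down[OF \<Delta> step(1) lt])
    then show ?thesis
      using lt swap by (auto simp: coef_T coef_add coef_scale y gy gx step(1))
  qed
  then show ?case
    using step(2)
    by (simp add: distrib_left scale_mult(2)[symmetric] coef_add coef_scale algebra_simps split: if_splits)
qed

lemma coef_mult_gen:
  assumes \<alpha>: "\<alpha> \<in> wall_roots" and y: "y \<in> carrier G"
  shows "coef (h * T (gen \<alpha>)) y = (if lth (y \<otimes>\<^bsub>G\<^esub> gen \<alpha>) < lth y
    then coef h (y \<otimes>\<^bsub>G\<^esub> gen \<alpha>) + (of_nat (q (wall_reflection \<alpha>)) - 1) * coef h y
    else of_nat (q (wall_reflection \<alpha>)) * coef h (y \<otimes>\<^bsub>G\<^esub> gen \<alpha>))"
proof (induction h rule: T_induct)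
  case zero
  show ?case by (simp add: coef_zero)
next
  case (step c x h)
  let ?g = "gen \<alpha>" and ?q = "of_nat (q (wall_reflection \<alpha>)) :: complex"
  note g = gen_carrier[OF \<alpha>] and \<Delta> = gen_in_Delta[OF \<alpha>]
  have gy: "y \<otimes>\<^bsub>G\<^esub> ?g \<in> carrier G" and gx: "x \<otimes>\<^bsub>G\<^esub> ?g \<in> carrier G" using g y step(1) by auto
  have swap: "y = x \<otimes>\<^bsub>G\<^esub> ?g \<longleftrightarrow> y \<otimes>\<^bsub>G\<^esub> ?g = x"
    using gen_gen_mult(2)[OF \<alpha>] y step(1) by metis
  have "coef (T x * T ?g) y = (if lth (y \<otimes>\<^bsub>G\<^esub> ?g) < lth y
    then coef (T x) (y \<otimes>\<^bsub>G\<^esub> ?g) + (?q - 1) * coef (T x) y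
    else ?q * coef (T x) (y \<otimes>\<^bsub>G\<^esub> ?g))"
  proof (cases "lth x < lth (x \<otimes>\<^bsub>G\<^esub> ?g)")
    case True
    then have "T x * T ?g = T (x \<otimes>\<^bsub>G\<^esub> ?g)" by (rule T_right_up[OF \<Delta> step(1)])
    then show ?thesis
      using True swap by (auto simp: coef_T y gy gx step(1))
  next
    case False
    then have lt: "lth (x \<otimes>\<^bsub>G\<^esub> ?g) < lth x"
      using lth_gen_neq(2)[OF \<alpha> step(1)] by simp
    have "T x * T ?g = smul (?q - 1) (T x) + smul ?q (T (x \<otimes>\<^bsub>G\<^esub> ?g))"
      by (rule T_right_down[OF \<Delta> step(1) lt])
    then show ?thesis
      using lt swap by (auto simp: coef_T coef_add coef_scale y gy gx step(1))
  qed
  then show ?case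
    using step(2)
    by (simp add: distrib_right scale_mult(1)[symmetric] coef_add coef_scale algebra_simps split: if_splits)
qed

text \<open>Compare the coefficients of \<open>T\<^sub>s * z = z * T\<^sub>s\<close> at whichever of
  \<open>s x\<close> and \<open>x s\<close> is longer than \<open>x\<close>.\<close>

lemma center_coef_conj_gen:
  assumes z: "z \<in> center" and \<alpha>: "\<alpha> \<in> wall_roots" and x: "x \<in> carrier G"
    and up: "lth x < lth (gen \<alpha> \<otimes>\<^bsub>G\<^esub> x) \<or> lth x < lth (x \<otimes>\<^bsub>G\<^esub> gen \<alpha>)"
  shows "coef z (gen \<alpha> \<otimes>\<^bsub>G\<^esub> x \<otimes>\<^bsub>G\<^esub> gen \<alpha>) = coef z x \<or>
    (\<exists>y\<in>carrier G. lth x < lth y \<and> lth y < lth (gen \<alpha> \<otimes>\<^bsub>G\<^esub> x \<otimes>\<^bsub>G\<^esub> gen \<alpha>) \<and>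
      coef z x + (of_nat (q (wall_reflection \<alpha>)) - 1) * coef z y
        = of_nat (q (wall_reflection \<alpha>)) * coef z (gen \<alpha> \<otimes>\<^bsub>G\<^esub> x \<otimes>\<^bsub>G\<^esub> gen \<alpha>))"
proof -
  let ?g = "gen \<alpha>" and ?c = "gen \<alpha> \<otimes>\<^bsub>G\<^esub> x \<otimes>\<^bsub>G\<^esub> gen \<alpha>"
  note g = gen_carrier[OF \<alpha>]
  have comm: "T ?g * z = z * T ?g" using z by (simp add: center_def)
  note left = coef_gen_mult[OF \<alpha>, of _ z] and right = coef_mult_gen[OF \<alpha>, of _ z]
  have gx: "?g \<otimes>\<^bsub>G\<^esub> x \<in> carrier G" and xg: "x \<otimes>\<^bsub>G\<^esub> ?g \<in> carrier G" using g x by auto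
  show ?thesis
    using up
  proof
    assume lt: "lth x < lth (?g \<otimes>\<^bsub>G\<^esub> x)"
    have e: "?g \<otimes>\<^bsub>G\<^esub> (?g \<otimes>\<^bsub>G\<^esub> x) = x" by (rule gen_gen_mult(1)[OF \<alpha> x])
    have "lth ?c \<noteq> lth (?g \<otimes>\<^bsub>G\<^esub> x)" by (rule lth_gen_neq(2)[OF \<alpha> gx])
    \<comment> \<open>If \<open>s x s\<close> is shorter than \<open>s x\<close>, the terms with
      factor \<open>q s - 1\<close> occur on both sides and cancel; otherwise the second alternative
      holds with \<open>s x\<close> as \<open>y\<close>.\<close>
    then show ?thesis
      using left[OF gx] right[OF gx] comm lt gx unfolding e
      by (cases "lth ?c < lth (?g \<otimes>\<^bsub>G\<^esub> x)") auto
  next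
    assume lt: "lth x < lth (x \<otimes>\<^bsub>G\<^esub> ?g)"
    have e: "(x \<otimes>\<^bsub>G\<^esub> ?g) \<otimes>\<^bsub>G\<^esub> ?g = x" by (rule gen_gen_mult(2)[OF \<alpha> x])
    have c: "?g \<otimes>\<^bsub>G\<^esub> (x \<otimes>\<^bsub>G\<^esub> ?g) = ?c" using g x by (simp add: G.m_assoc)
    have "lth ?c \<noteq> lth (x \<otimes>\<^bsub>G\<^esub> ?g)" unfolding c[symmetric] by (rule lth_gen_neq(1)[OF \<alpha> xg])
    then show ?thesis
      using left[OF xg] right[OF xg] comm lt xg unfolding e c
      by (cases "lth ?c < lth (x \<otimes>\<^bsub>G\<^esub> ?g)") auto
  qed
qed

lemma center_support_meets_Lambda:
  assumes z: "z \<in> center" "z \<noteq> 0"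
  shows "\<exists>t\<in>\<Lambda> \<Sigma> \<Omega> \<psi>. coef z t \<noteq> 0"
proof (rule ccontr)
  assume none: "\<not> ?thesis"
  define S where "S = {x \<in> carrier G. coef z x \<noteq> 0}"
  have "finite S" unfolding S_def by (rule finite_support)
  have "S \<noteq> {}" using coef_eq_zero[of z] z(2) unfolding S_def by blast
  have "S \<subseteq> carrier G - \<Lambda> \<Sigma> \<Omega> \<psi>" using none unfolding S_def by blast
  then obtain b where b: "b \<in> C"
    "\<And>x. x \<in> S \<Longrightarrow> 2 *\<^sub>R b - act x b - act (inv\<^bsub>G\<^esub> x) b \<noteq> 0"
    using exists_generic_point[OF \<open>finite S\<close>] by blast
  define n where "n = Max (lth ` S)"
  have n: "lth x \<le> n" if "x \<in> S" for x using \<open>finite S\<close> that by (simp add: n_def)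
  define S' where "S' = {x \<in> S. lth x = n}"
  have "n \<in> lth ` S" unfolding n_def using \<open>finite S\<close> \<open>S \<noteq> {}\<close> by (intro Max_in) auto
  then have "S' \<noteq> {}" "finite S'" using \<open>finite S\<close> by (auto simp: S'_def)
  define disp where "disp x = norm (act x b - b)" for x
  have "Max (disp ` S') \<in> disp ` S'" using \<open>S' \<noteq> {}\<close> \<open>finite S'\<close> by (intro Max_in) auto
  then obtain x where "x \<in> S'" "disp x = Max (disp ` S')" by auto
  then have max: "disp y \<le> disp x" if "y \<in> S'" for y using \<open>finite S'\<close> that by simp
  have x: "x \<in> S" "x \<in> carrier G" "coef z x \<noteq> 0" "lth x = n"
    using \<open>x \<in> S'\<close> by (auto simp: S'_def S_def)
  obtain \<alpha> where \<alpha>: "\<alpha> \<in> wall_roots"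
    and up: "lth x < lth (gen \<alpha> \<otimes>\<^bsub>G\<^esub> x) \<or> lth x < lth (x \<otimes>\<^bsub>G\<^esub> gen \<alpha>)"
    and disp: "disp x < disp (gen \<alpha> \<otimes>\<^bsub>G\<^esub> x \<otimes>\<^bsub>G\<^esub> gen \<alpha>)"
    using exists_wall_increase[OF x(2) b(1) b(2)[OF x(1)]] unfolding disp_def by blast
  let ?c = "gen \<alpha> \<otimes>\<^bsub>G\<^esub> x \<otimes>\<^bsub>G\<^esub> gen \<alpha>"
  have c: "?c \<in> carrier G" using gen_carrier[OF \<alpha>] x(2) by auto
  have long: "coef z y = 0" if "y \<in> carrier G" "n < lth y" for y
    using n[of y] that unfolding S_def by force
  from center_coef_conj_gen[OF z(1) \<alpha> x(2) up] show False
  proof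
    assume "coef z ?c = coef z x"
    then have "?c \<in> S" using c x(3) by (simp add: S_def)
    \<comment> \<open>Conjugation does not shorten \<open>x\<close>, and nothing in the support is
      longer than \<open>n\<close>.\<close>
    moreover have "lth ?c = n" using lth_conj_ge[OF \<alpha> x(2) up] x(4) n[OF \<open>?c \<in> S\<close>] by simp
    ultimately have "?c \<in> S'" by (simp add: S'_def)
    then show False using max disp by fastforce
  next
    assume "\<exists>y\<in>carrier G. lth x < lth y \<and> lth y < lth ?c \<and>
      coef z x + (of_nat (q (wall_reflection \<alpha>)) - 1) * coef z y
        = of_nat (q (wall_reflection \<alpha>)) * coef z ?c"
    then obtain y where y: "y \<in> carrier G" "lth x < lth y" "lth y < lth ?c"
      "coef z x + (of_nat (q (wall_reflection \<alpha>)) - 1) * coef z y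
        = of_nat (q (wall_reflection \<alpha>)) * coef z ?c" by blast
    \<comment> \<open>Both elements are longer than anything in the support, so the relation leaves
      the coefficient at \<open>x\<close> equal to 0, whatever \<open>q\<close> is.\<close>
    have "coef z y = 0" "coef z ?c = 0" using y x(4) c by (intro long; simp)+
    then show False using y(4) x(3) by simp
  qed
qed

section \<open>Constancy of central coefficients on conjugacy classes\<close>

lemma Lambda_normal: "\<Lambda> \<Sigma> \<Omega> \<psi> \<lhd> G"
  using semidirect by (simp add: internal_semidirect_def)

lemma conjugate_Lambda:
  "x \<in> carrier G \<Longrightarrow> t \<in> \<Lambda> \<Sigma> \<Omega> \<psi> \<Longrightarrow> conjugate G x t \<in> \<Lambda> \<Sigma> \<Omega> \<psi>"
  unfolding conjugate_def by (rule normal.inv_op_closed2[OF Lambda_normal])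

text \<open>It is enough to conjugate by one wall reflection fixing \<open>v\<close> at a time,
  since \<open>\<Lambda>\<close> is normal and every intermediate conjugate is again in it.\<close>

lemma center_coef_conj_W_fin:
  assumes z: "z \<in> center" and g: "g \<in> W_fin \<Sigma> v \<Omega>" and "t \<in> \<Lambda> \<Sigma> \<Omega> \<psi>"
  shows "coef z (conjugate G g t) = coef z t"
proof -
  obtain w where w: "w \<in> W_aff \<Sigma>" "w v = v" "g = (w, \<one>\<^bsub>\<Omega>\<^esub>)"
    using g by (auto simp: W_fin_def)
  have "\<forall>t\<in>\<Lambda> \<Sigma> \<Omega> \<psi>. coef z (conjugate G (w, \<one>\<^bsub>\<Omega>\<^esub>) t) = coef z t"
    using w(1,2) alcove(2)
  proof (induction rule: stabilizer_induct)
    case id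
    have "(id, \<one>\<^bsub>\<Omega>\<^esub>) = \<one>\<^bsub>G\<^esub>" by (simp add: one_G)
    moreover have "conjugate G \<one>\<^bsub>G\<^esub> t = t" if "t \<in> \<Lambda> \<Sigma> \<Omega> \<psi>" for t
      using Lambda_carrier[OF that] by (simp add: conjugate_def)
    ultimately show ?case by (simp add: id_def)
  next
    case (step \<alpha> w)
    have "coef z (conjugate G (wall_reflection \<alpha> \<circ> w, \<one>\<^bsub>\<Omega>\<^esub>) t) = coef z t"
      if t: "t \<in> \<Lambda> \<Sigma> \<Omega> \<psi>" for t
    proof -
      let ?g = "gen \<alpha>" and ?w = "(w, \<one>\<^bsub>\<Omega>\<^esub>)"
      note \<alpha> = step(1)
      have g: "?g \<in> carrier G" and w: "?w \<in> carrier G"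
        using gen_carrier[OF \<alpha>] step(3) by (auto simp: carrier_G)
      have gw: "(wall_reflection \<alpha> \<circ> w, \<one>\<^bsub>\<Omega>\<^esub>) = ?g \<otimes>\<^bsub>G\<^esub> ?w"
        using gen_mult[OF \<alpha> w] by simp
      define t' where "t' = conjugate G ?w t"
      have t': "t' \<in> \<Lambda> \<Sigma> \<Omega> \<psi>" "t' \<in> carrier G"
        using conjugate_Lambda[OF w t] Lambda_carrier by (auto simp: t'_def)
      have conj: "conjugate G (?g \<otimes>\<^bsub>G\<^esub> ?w) t = ?g \<otimes>\<^bsub>G\<^esub> t' \<otimes>\<^bsub>G\<^esub> ?g"
        using g w Lambda_carrier[OF t]
        by (simp add: conjugate_def t'_def G.inv_mult_group inv_gen[OF \<alpha>] G.m_assoc)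
      have "?g \<in> W_fin \<Sigma> v \<Omega>" using g step(2) by (auto simp: W_fin_def carrier_G)
      then have "lth (?g \<otimes>\<^bsub>G\<^esub> t' \<otimes>\<^bsub>G\<^esub> ?g) = lth t'"
        using len_conj[of ?g t'] t'(1) by (simp add: conjugate_def inv_gen[OF \<alpha>])
      \<comment> \<open>Constancy of length on the class rules out the second alternative, which
        would make the conjugate strictly longer.\<close>
      then have "coef z (?g \<otimes>\<^bsub>G\<^esub> t' \<otimes>\<^bsub>G\<^esub> ?g) = coef z t'"
        using center_coef_conj_gen[OF z \<alpha> t'(2) translation_increase[OF \<alpha> t'(1)]] by auto
      then show ?thesis
        unfolding gw conj using step(5) t by (simp add: t'_def)
    qed
    then show ?case by (simp add: comp_def)
  qed
  then show ?thesis using assms(3) w(3) by blast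
qed

section \<open>Conjugacy classes and the dimension bound\<close>

definition conj_class :: "('a \<Rightarrow> 'a) \<times> 'o \<Rightarrow> (('a \<Rightarrow> 'a) \<times> 'o) set" where
  "conj_class t = (\<lambda>g. conjugate G g t) ` W_fin \<Sigma> v \<Omega>"

lemma conj_class_self:
  assumes "t \<in> \<Lambda> \<Sigma> \<Omega> \<psi>"
  shows "t \<in> conj_class t"
proof -
  have "\<one>\<^bsub>G\<^esub> \<in> W_fin \<Sigma> v \<Omega>" using W_aff_id by (auto simp: W_fin_def one_G)
  moreover have "conjugate G \<one>\<^bsub>G\<^esub> t = t" using Lambda_carrier[OF assms] by (simp add: conjugate_def)
  ultimately show ?thesis unfolding conj_class_def by force
qed

lemma class_len_conj_class:
  assumes "t \<in> \<Lambda> \<Sigma> \<Omega> \<psi>"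
  shows "class_len \<Sigma> C (conj_class t) = lth t"
proof -
  have "lth ` conj_class t = {lth t}"
    using conj_class_self[OF assms] len_conj[OF _ assms] by (auto simp: conj_class_def)
  then show ?thesis by (simp add: class_len_def)
qed

text \<open>The finite Weyl group has trivial \<open>\<Omega>\<close>-component, so conjugating by
  it cannot change that component.\<close>

lemma snd_conj_class:
  assumes "t \<in> \<Lambda> \<Sigma> \<Omega> \<psi>" "u \<in> conj_class t"
  shows "snd u = snd t"
proof -
  obtain g where g: "g \<in> W_fin \<Sigma> v \<Omega>" "u = conjugate G g t"
    using assms(2) by (auto simp: conj_class_def)
  have "snd g = \<one>\<^bsub>\<Omega>\<^esub>" using g(1) by (auto simp: W_fin_def)
  moreover have "g \<in> carrier G" "t \<in> carrier G" "snd t \<in> carrier \<Omega>"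
    using W_fin_carrier[OF g(1)] Lambda_carrier[OF assms(1)] carrier_G by auto
  ultimately show ?thesis
    by (simp add: g(2) conjugate_def snd_mult snd_inv)
qed

lemma N_classes_eq:
  "N_classes \<Sigma> v C \<Omega> \<psi> L \<tau> = conj_class ` {t \<in> \<Lambda> \<Sigma> \<Omega> \<psi>. lth t \<le> L \<and> snd t = \<tau>}"
proof -
  have "conj_classes \<Sigma> v \<Omega> \<psi> = conj_class ` \<Lambda> \<Sigma> \<Omega> \<psi>"
    by (auto simp: conj_classes_def conj_class_def)
  then show ?thesis
    using class_len_conj_class conj_class_self snd_conj_class by (fastforce simp: N_classes_def)
qed

lemma finite_N_classes: "finite (N_classes \<Sigma> v C \<Omega> \<psi> L \<tau>)"
  unfolding N_classes_eq
  by (intro finite_imageI finite_subset[OF _ finite_bounded_length[of L \<tau>]])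
    (auto dest: Lambda_carrier)

lemma Z_part_subspace: "H.subspace (Z_part \<Sigma> C \<Omega> \<psi> smul T L \<tau>)"
proof (rule H.subspaceI)
  have "smul c z \<in> center" if "z \<in> center" for c z
    using that unfolding center_def
    by (simp only: mem_Collect_eq scale_mult(1)[symmetric] scale_mult(2)[symmetric]) simp
  then show "smul c z \<in> Z_part \<Sigma> C \<Omega> \<psi> smul T L \<tau>" if "z \<in> Z_part \<Sigma> C \<Omega> \<psi> smul T L \<tau>" for c z
    using that by (simp add: Z_part_def coef_scale)
qed (simp_all add: Z_part_def center_def coef_zero coef_add distrib_left distrib_right)

text \<open>A central element is sent to its part supported on one chosen representative per class.
  If that part is 0, constancy on classes makes all coefficients on \<open>\<Lambda>\<close> vanish:
  outside the counted classes they are 0 by the definition of \<open>Z_part\<close>. So the element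
  is 0.\<close>

lemma Z_part_dim_le:
  "(\<exists>B. finite B \<and> Z_part \<Sigma> C \<Omega> \<psi> smul T L \<tau> \<subseteq> H.span B) \<and>
    H.dim (Z_part \<Sigma> C \<Omega> \<psi> smul T L \<tau>) \<le> card (N_classes \<Sigma> v C \<Omega> \<psi> L \<tau>)"
proof -
  let ?Z = "Z_part \<Sigma> C \<Omega> \<psi> smul T L \<tau>" and ?N = "N_classes \<Sigma> v C \<Omega> \<psi> L \<tau>"
  define R where "R = (\<lambda>K. SOME t. t \<in> K) ` ?N"
  have "finite R" unfolding R_def using finite_N_classes by blast
  have "R \<subseteq> carrier G"
  proof
    fix u assume "u \<in> R"
    then obtain t where t: "t \<in> \<Lambda> \<Sigma> \<Omega> \<psi>" "u = (SOME t'. t' \<in> conj_class t)"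
      by (auto simp: R_def N_classes_eq)
    then have "u \<in> conj_class t" using conj_class_self someI by metis
    then obtain g where "g \<in> W_fin \<Sigma> v \<Omega>" "u = conjugate G g t"
      by (auto simp: conj_class_def)
    then show "u \<in> carrier G"
      using conjugate_Lambda[OF W_fin_carrier t(1)] Lambda_carrier by metis
  qed
  \<comment> \<open>The values are kept in the algebra itself rather than in a space of functions on
    \<open>R\<close>, so that source and target have the same scalar multiplication.\<close>
  define f where "f h = (\<Sum>u\<in>R. smul (coef h u) (T u))" for h
  have coef_f: "coef (f h) u = coef h u" if "u \<in> R" for h u
  proof -
    have "coef (\<Sum>u\<in>F. smul (coef h u) (T u)) u = (if u \<in> F then coef h u else 0)"
      if "finite F" "F \<subseteq> R" for F
      using that
    proof (induction F rule: finite_induct)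
      case (insert x F)
      then have "x \<in> carrier G" "u \<in> carrier G" using \<open>R \<subseteq> carrier G\<close> \<open>u \<in> R\<close> by auto
      then show ?case using insert by (auto simp: coef_add coef_scale coef_T)
    qed (simp add: coef_zero)
    from this[OF \<open>finite R\<close>] show ?thesis using that by (simp add: f_def)
  qed
  have "Vector_Spaces.linear smul smul f"
    by unfold_locales
      (simp_all add: f_def coef_add coef_scale H.scale_left_distrib sum.distrib H.scale_sum_right)
  moreover have "h = 0" if "h \<in> ?Z" "f h = 0" for h
  proof (rule ccontr)
    assume "h \<noteq> 0"
    have h: "h \<in> center" using that(1) by (simp add: Z_part_def)
    then obtain t where t: "t \<in> \<Lambda> \<Sigma> \<Omega> \<psi>" "coef h t \<noteq> 0"
      using center_support_meets_Lambda \<open>h \<noteq> 0\<close> by blast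
    then have "lth t \<le> L" "snd t = \<tau>"
      using that(1) Lambda_carrier[OF t(1)] by (auto simp: Z_part_def not_less[symmetric])
    then have K: "conj_class t \<in> ?N" using t(1) by (auto simp: N_classes_eq)
    define u where "u = (SOME u. u \<in> conj_class t)"
    have "u \<in> conj_class t" using conj_class_self[OF t(1)] someI unfolding u_def by metis
    then have "coef h u = coef h t"
      using center_coef_conj_W_fin[OF h _ t(1)] by (auto simp: conj_class_def)
    moreover have "u \<in> R" using K by (auto simp: R_def u_def)
    ultimately show False using coef_f[of u h] that(2) t(2) by (simp add: coef_zero)
  qed
  moreover have "finite (T ` R)" using \<open>finite R\<close> by blast
  moreover have "f ` ?Z \<subseteq> H.span (T ` R)"
    unfolding f_def by (intro image_subsetI H.span_sum H.span_scale H.span_base imageI)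
  ultimately have "(\<exists>B. finite B \<and> ?Z \<subseteq> H.span B) \<and> H.dim ?Z \<le> card (T ` R)"
    by (intro H.dim_le_card_linear_injective[OF Z_part_subspace]) auto
  moreover have "card (T ` R) \<le> card ?N"
    using card_image_le[OF \<open>finite R\<close>, of T] card_image_le[OF finite_N_classes]
    unfolding R_def by (meson le_trans)
  ultimately show ?thesis by (meson le_trans)
qed

end

text \<open>Both \<open>card\<close> and \<open>dim\<close> give 0 in the infinite case. The two
  finiteness claims ensure that the inequality compares a genuine dimension with a genuine number of
  classes.\<close>

theorem proposition8p3p1:
  fixes \<Sigma> :: "'a::euclidean_space set" and v :: 'a and C :: "'a set"
    and \<Omega> :: "('o, 'm) monoid_scheme" and \<psi> :: "'o \<Rightarrow> 'a \<Rightarrow> 'a"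
    and smul :: "complex \<Rightarrow> 'h::ring_1 \<Rightarrow> 'h"
    and q :: "('a \<Rightarrow> 'a) \<Rightarrow> nat" and T :: "('a \<Rightarrow> 'a) \<times> 'o \<Rightarrow> 'h"
    and L :: nat and \<tau> :: 'o
  assumes "hecke_algebra \<Sigma> v C \<Omega> \<psi> smul q T"
    and "\<tau> \<in> carrier \<Omega>"
  shows "finite (N_classes \<Sigma> v C \<Omega> \<psi> L \<tau>) \<and>
    (\<exists>B. finite B \<and> Z_part \<Sigma> C \<Omega> \<psi> smul T L \<tau> \<subseteq> module.span smul B) \<and>
    vector_space.dim smul (Z_part \<Sigma> C \<Omega> \<psi> smul T L \<tau>) \<le> card (N_classes \<Sigma> v C \<Omega> \<psi> L \<tau>)"
proof -
  interpret hecke_algebra \<Sigma> v C \<Omega> \<psi> smul q T by (rule assms(1))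
  show ?thesis using finite_N_classes Z_part_dim_le by blast
qed

end
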